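(* Let $M\in\mathbb{R}^{p\times v}[s]$ be a polynomial matrix of full row rank, let $G=(R,C;E)$ be the edge-weighted bipartite graph associated to $M$, and assume that $G$ has at least one $R$-saturating matching. Let $G_{nr}$ be the graph obtained from $G$ by removing all redundant edges, and let $g_1,g_2,\dots,g_c$ be the connected components of $G_{nr}$. Then, generically, $M(\lambda)$ has full row rank for every complex number $\lambda\in\mathbb{C}$ if and only if, for every component $g_i$ satisfying $|R(g_i)|=|C(g_i)|$, all edges in $g_i$ have weight zero. (That is: the property "$M(\lambda)$ has full row rank for all $\lambda\in\mathbb{C}$" holds generically if and only if the stated condition on components holds.)
   Context: $\mathbb{R}^{p\times v}[s]$ denotes the $p\times v$ matrices with entries in $\mathbb{R}[s]$. Associated graph: the edge-weighted bipartite graph $G=(R,C;E)$ associated to $M$ has $R$ = the set of rows, $C$ = the set of columns, an edge between row $i$ and column $j$ exactly when the $(i,j)$ entry of $M$ is a nonzero polynomial, and the weight of that edge is the degree of that polynomial (weight zero means a nonzero constant entry). A matching is a set of edges such that each vertex lies on at most one of them; it is $R$-saturating if it has $|R|$ edges. An edge of $G$ is redundant if it belongs to no $R$-saturating matching of $G$. $G_{nr}$ keeps all vertices of $G$. For a component $g$ of $G_{nr}$, $R(g)$ and $C(g)$ denote the sets of vertices of $g$ lying in $R$ and $C$ respectively. Genericity: the nonzero entries of $M$ are regarded as chosen independently. That is, let $d_{ij}$ be the weight of the edge $(i,j)\in E$, and consider all matrices whose $(i,j)$ entry is $0$ if $(i,j)\notin E$ and is $\sum_{k=0}^{d_{ij}}a_{ij,k}s^k$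 if $(i,j)\in E$, with all coefficients $a_{ij,k}$ regarded as independent real parameters ($N$ of them in total). A property holds generically for $M$ if the set of parameter values in $\mathbb{R}^N$ for which it fails is contained in a nontrivial algebraic variety, i.e. in the solution set of $f=0$ for some nonzero polynomial $f$ in the $N$ parameters. *)

theory Defs
  imports
    "HOL-Analysis.Analysis"
    "HOL-Computational_Algebra.Polynomial_Factorial"
    "HOL-Library.Poly_Mapping"
begin

section \<open>Polynomial matrices and their rank\<close>

definition full_row_rank :: "'a::field ^ 'v ^ 'p \<Rightarrow> bool" where
  "full_row_rank A \<longleftrightarrow> rank A = CARD('p)"

text \<open>The rank of a real polynomial matrix is its rank over the field of rational functions.\<close>

definition poly_full_row_rank :: "real poly ^ 'v ^ 'p \<Rightarrow> bool" where
  "poly_full_row_rank M \<longleftrightarrow> full_row_rank (map_matrix to_fract M)"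

definition eval_matrix :: "real poly ^ 'v ^ 'p \<Rightarrow> complex \<Rightarrow> complex ^ 'v ^ 'p" where
  "eval_matrix M z = map_matrix (\<lambda>q. poly (map_poly complex_of_real q) z) M"


section \<open>The associated edge-weighted bipartite graph\<close>

text \<open>The two vertex classes are the full types of row and column indices, so a bipartite graph
  on them is given by its edge set alone.\<close>

definition edges :: "real poly ^ 'v ^ 'p \<Rightarrow> ('p \<times> 'v) set" where
  "edges M = {(i, j). M $ i $ j \<noteq> 0}"

definition weight :: "real poly ^ 'v ^ 'p \<Rightarrow> 'p \<times> 'v \<Rightarrow> nat" where
  "weight M = (\<lambda>(i, j). degree (M $ i $ j))"

definition matching :: "('p \<times> 'v) set \<Rightarrow> ('p \<times> 'v) set \<Rightarrow> bool" where
  "matching E F \<longleftrightarrow> F \<subseteq> E \<and>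
     (\<forall>e\<in>F. \<forall>e'\<in>F. fst e = fst e' \<or> snd e = snd e' \<longrightarrow> e = e')"

definition row_saturating_matching ::
    "('p::finite \<times> 'v::finite) set \<Rightarrow> ('p \<times> 'v) set \<Rightarrow> bool" where
  "row_saturating_matching E F \<longleftrightarrow> matching E F \<and> card F = CARD('p)"

definition redundant :: "('p::finite \<times> 'v::finite) set \<Rightarrow> 'p \<times> 'v \<Rightarrow> bool" where
  "redundant E e \<longleftrightarrow> e \<in> E \<and> \<not> (\<exists>F. row_saturating_matching E F \<and> e \<in> F)"

definition nonredundant_edges :: "('p::finite \<times> 'v::finite) set \<Rightarrow> ('p \<times> 'v) set" where
  "nonredundant_edges E = {e \<in> E. \<not> redundant E e}"

text \<open>Vertices are elements of the disjoint sum of row and column indices. A component is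
  represented by its vertex set; a vertex without incident edges is a component of its own.\<close>

definition adjacency :: "('p \<times> 'v) set \<Rightarrow> ('p + 'v) rel" where
  "adjacency E = {(Inl i, Inr j) | i j. (i, j) \<in> E} \<union> {(Inr j, Inl i) | i j. (i, j) \<in> E}"

definition graph_components :: "('p \<times> 'v) set \<Rightarrow> ('p + 'v) set set" where
  "graph_components E = UNIV // (adjacency E)\<^sup>*"

definition row_part :: "('p + 'v) set \<Rightarrow> 'p set" where
  "row_part g = {i. Inl i \<in> g}"

definition col_part :: "('p + 'v) set \<Rightarrow> 'v set" where
  "col_part g = {j. Inr j \<in> g}"

definition component_edges :: "('p \<times> 'v) set \<Rightarrow> ('p + 'v) set \<Rightarrow> ('p \<times> 'v) set" where
  "component_edges E g = {(i, j) \<in> E. Inl i \<in> g \<and> Inr j \<in> g}"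


section \<open>Genericity\<close>

text \<open>A polynomial in the variables \<open>x :: 'x\<close> is a finitely supported map from monomials to
  coefficients, a monomial being a finitely supported map from variables to exponents.\<close>

type_synonym ('x, 'a) multi_poly = "('x \<Rightarrow>\<^sub>0 nat) \<Rightarrow>\<^sub>0 'a"

definition multi_vars :: "('x, 'a::zero) multi_poly \<Rightarrow> 'x set" where
  "multi_vars f = (\<Union>m\<in>Poly_Mapping.keys f. Poly_Mapping.keys m)"

definition multi_eval :: "('x, 'a::comm_semiring_1) multi_poly \<Rightarrow> ('x \<Rightarrow> 'a) \<Rightarrow> 'a" where
  "multi_eval f a = (\<Sum>m\<in>Poly_Mapping.keys f. Poly_Mapping.lookup f m *
     (\<Prod>x\<in>Poly_Mapping.keys m. a x ^ Poly_Mapping.lookup m x))"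

text \<open>The index \<open>(i, j, k)\<close> stands for the coefficient of degree \<open>k\<close> in the entry \<open>(i, j)\<close>.\<close>

definition parameters :: "('p \<times> 'v) set \<Rightarrow> ('p \<times> 'v \<Rightarrow> nat) \<Rightarrow> ('p \<times> 'v \<times> nat) set" where
  "parameters E d = {(i, j, k). (i, j) \<in> E \<and> k \<le> d (i, j)}"

definition structured_matrix ::
    "('p \<times> 'v) set \<Rightarrow> ('p \<times> 'v \<Rightarrow> nat) \<Rightarrow> ('p \<times> 'v \<times> nat \<Rightarrow> real) \<Rightarrow> real poly ^ 'v ^ 'p" where
  "structured_matrix E d a =
     (\<chi> i j. if (i, j) \<in> E then \<Sum>k\<le>d (i, j). monom (a (i, j, k)) k else 0)"

text \<open>The parameter space is the set of extensional real-valued functions on the finite set of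
  parameters.\<close>

definition holds_generically ::
    "('p \<times> 'v) set \<Rightarrow> ('p \<times> 'v \<Rightarrow> nat) \<Rightarrow> (real poly ^ 'v ^ 'p \<Rightarrow> bool) \<Rightarrow> bool" where
  "holds_generically E d P \<longleftrightarrow>
     (\<exists>f :: ('p \<times> 'v \<times> nat, real) multi_poly.
        f \<noteq> 0 \<and> multi_vars f \<subseteq> parameters E d \<and>
        {a \<in> parameters E d \<rightarrow>\<^sub>E UNIV. \<not> P (structured_matrix E d a)}
          \<subseteq> {a \<in> parameters E d \<rightarrow>\<^sub>E UNIV. multi_eval f a = 0})"

end

theory Submission
  imports Defs "HOL-Computational_Algebra.Fundamental_Theorem_Algebra"
begin

text \<open>
  Redundant edges contribute to no maximal minor, so \<open>M\<close> may be replaced by its nonredundant part,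
  which is block diagonal along the components. The determinant of a square block with an edge of
  positive weight has generically positive degree, hence a root, where the rank drops.

  Conversely, an alternating path argument shows that the columns that lie in every saturating
  matching are exactly covered by square components, so their entries are constants. By Euclid's
  algorithm over the parameters, the maximal minors either generically have a common root or
  generically have none. The first case is excluded by exhibiting, outside any given hypersurface,
  a point where they have no common root: the minor that avoids a column \<open>j\<close> is not affected by
  the parameters of column \<open>j\<close>, so a persistent common root cannot depend on any column that some
  saturating matching avoids. Such a root would survive the specialization of these columns to
  constants for which the matrix has a nonzero constant minor.
\<close>

section \<open>Rank and maximal minors\<close>

text \<open>\<open>rows A\<close> is a set, so repeated rows count once in the rank. Both directions
  therefore show first that the rows are pairwise distinct; then independence of the set and of the
  indexed family agree.\<close>

lemma full_row_rank_iff_left_kernel: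
  fixes A :: "'a::field ^ 'v ^ 'p"
  shows "full_row_rank A \<longleftrightarrow> (\<forall>x. x v* A = 0 \<longrightarrow> x = 0)"
proof -
  have rows_image: "rows A = (\<lambda>i. row i A) ` UNIV" by (auto simp: rows_def)
  have fin: "finite (rows A)" unfolding rows_image by (rule finite_imageI) (rule finite)
  have kernel: "(\<forall>x. x v* A = 0 \<longrightarrow> x = 0) \<longleftrightarrow>
      (\<forall>c. (\<Sum>i\<in>UNIV. c i *s row i A) = 0 \<longrightarrow> (\<forall>i. c i = 0))"
    unfolding matrix_right_invertible_independent_rows[symmetric]
    unfolding left_invertible_transpose[symmetric] matrix_left_invertible_ker transpose_matrix_vector ..
  show ?thesis
  proof
    assume "full_row_rank A"
    then have dim: "vec.dim (rows A) = CARD('p)"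
      by (simp add: full_row_rank_def row_rank_def_gen)
    have "card (rows A) \<le> CARD('p)" unfolding rows_image by (rule card_image_le) simp
    moreover have "vec.dim (rows A) \<le> card (rows A)" using fin by (rule vec.dim_le_card')
    ultimately have card: "card (rows A) = CARD('p)" using dim by simp
    then have inj: "inj (\<lambda>i. row i A)"
      unfolding rows_image by (intro eq_card_imp_inj_on) auto
    have indep: "vec.independent (rows A)"
      by (rule vec.card_le_dim_spanning[OF order_refl vec.span_superset fin]) (simp add: card dim)
    have "c i = 0" if c: "(\<Sum>i\<in>UNIV. c i *s row i A) = 0" for c i
    proof -
      let ?u = "\<lambda>y. c (inv (\<lambda>i. row i A) y)"
      have "(\<Sum>y\<in>rows A. ?u y *s y) = 0"
        unfolding rows_image by (subst sum.reindex[OF inj]) (simp add: inv_f_f[OF inj] c)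
      then have "?u (row i A) = 0"
        by (rule vec.independentD[OF indep fin order_refl]) (simp add: rows_image)
      then show ?thesis by (simp add: inv_f_f[OF inj])
    qed
    then show "\<forall>x. x v* A = 0 \<longrightarrow> x = 0" unfolding kernel by blast
  next
    assume "\<forall>x. x v* A = 0 \<longrightarrow> x = 0"
    then have zero: "c i = 0" if "(\<Sum>i\<in>UNIV. c i *s row i A) = 0" for c i
      using that unfolding kernel by blast
    have inj: "inj (\<lambda>i. row i A)"
    proof (rule injI, rule ccontr)
      fix i k assume ik: "row i A = row k A" "i \<noteq> k"
      let ?c = "\<lambda>l. if l = i then 1 else if l = k then - 1 else (0::'a)"
      have "(\<Sum>l\<in>UNIV. ?c l *s row l A) = (\<Sum>l\<in>{i, k}. ?c l *s row l A)"
        by (rule sum.mono_neutral_right) auto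
      also have "\<dots> = 0" using ik by (simp add: vec_eq_iff)
      finally show False using zero[of ?c i] by simp
    qed
    have "vec.independent (rows A)"
      unfolding vec.dependent_finite[OF fin]
    proof safe
      fix u v assume u: "(\<Sum>v\<in>rows A. u v *s v) = 0" and v: "v \<in> rows A" "u v \<noteq> 0"
      have "(\<Sum>i\<in>UNIV. u (row i A) *s row i A) = 0"
        using u unfolding rows_image by (subst (asm) sum.reindex[OF inj]) simp
      then have "u (row i A) = 0" for i using zero[of "\<lambda>i. u (row i A)"] by blast
      then show False using v unfolding rows_image by auto
    qed
    then have "vec.dim (rows A) = card (rows A)" by (rule vec.dim_eq_card_independent)
    also have "\<dots> = CARD('p)" unfolding rows_image by (simp add: card_image inj)
    finally show "full_row_rank A" by (simp add: full_row_rank_def row_rank_def_gen)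
  qed
qed

text \<open>Repeated columns are allowed in a minor; this only adds minors that vanish.\<close>

definition minor :: "'a::comm_ring_1 ^ 'v ^ 'p \<Rightarrow> ('p \<Rightarrow> 'v) \<Rightarrow> 'a" where
  "minor A \<sigma> = det (\<chi> i k. A $ i $ \<sigma> k)"

lemma left_kernel_trivial_iff_det:
  fixes A :: "'a::field ^ 'p ^ 'p"
  shows "(\<forall>x. x v* A = 0 \<longrightarrow> x = 0) \<longleftrightarrow> det A \<noteq> 0"
  by (metis det_transpose invertible_det_nz invertible_left_inverse matrix_left_invertible_ker
      transpose_matrix_vector)

text \<open>A left kernel vector of \<open>A\<close> is also one of every selection of columns.
  Conversely, at full row rank the columns span a space of dimension \<open>CARD('p)\<close>, and a
  basis chosen among them is the selection.\<close>

lemma full_row_rank_iff_minor: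
  fixes A :: "'a::field ^ 'v ^ 'p"
  shows "full_row_rank A \<longleftrightarrow> (\<exists>\<sigma>. minor A \<sigma> \<noteq> 0)"
proof
  assume "\<exists>\<sigma>. minor A \<sigma> \<noteq> 0"
  then obtain \<sigma> where \<sigma>: "minor A \<sigma> \<noteq> 0" by blast
  have "x = 0" if "x v* A = 0" for x
  proof -
    have "x v* (\<chi> i k. A $ i $ \<sigma> k) = 0"
      using that by (simp add: vec_eq_iff vector_matrix_mult_def)
    then show ?thesis using \<sigma> left_kernel_trivial_iff_det unfolding minor_def by blast
  qed
  then show "full_row_rank A" by (simp add: full_row_rank_iff_left_kernel)
next
  assume "full_row_rank A"
  then have "\<exists>B::'a^'p^'v. A ** B = mat 1"
    unfolding full_row_rank_iff_left_kernel
    by (metis left_invertible_transpose matrix_left_invertible_ker transpose_matrix_vector)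
  then have span: "vec.span (columns A) = UNIV"
    by (simp add: matrix_right_invertible_span_columns)
  obtain B where B: "B \<subseteq> columns A" "vec.independent B" "columns A \<subseteq> vec.span B"
      "card B = vec.dim (columns A)"
    using vec.basis_exists by blast
  have spanB: "vec.span B = UNIV"
    using B(3) span by (metis top.extremum_unique vec.span_minimal vec.subspace_span)
  have "card B = vec.dim (UNIV :: ('a^'p) set)"
    using spanB B(2) by (metis vec.dim_eq_card_independent vec.dim_span)
  then have cardB: "card B = CARD('p)" by (simp add: vec.dim_UNIV card_cart_basis vec.dimension_def)
  have "finite B" using B(2) by (simp add: vec.finiteI_independent)
  then obtain g :: "'p \<Rightarrow> 'a^'p" where g: "bij_betw g UNIV B"
    using cardB by (metis finite finite_same_card_bij)
  have "\<forall>k. \<exists>j. g k = column j A"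
    using g B(1) by (fastforce simp: bij_betw_def columns_def)
  then obtain \<sigma> where \<sigma>: "\<And>k. g k = column (\<sigma> k) A" by metis
  let ?A = "(\<chi> i k. A $ i $ \<sigma> k) :: 'a^'p^'p"
  have "column k ?A = g k" for k by (simp add: \<sigma> column_def)
  then have "columns ?A = B"
    using g by (auto simp: columns_def bij_betw_def)
  then have "\<exists>C. ?A ** C = mat 1"
    using spanB by (simp add: matrix_right_invertible_span_columns)
  then show "\<exists>\<sigma>. minor A \<sigma> \<noteq> 0"
    unfolding minor_def by (metis invertible_det_nz invertible_right_inverse)
qed

section \<open>Real polynomials at complex points\<close>

abbreviation cpoly :: "real poly \<Rightarrow> complex \<Rightarrow> complex" where
  "cpoly q z \<equiv> poly (map_poly complex_of_real q) z"

lemma cpoly_add: "cpoly (p + q) z = cpoly p z + cpoly q z"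
proof -
  have "map_poly complex_of_real (p + q) = map_poly complex_of_real p + map_poly complex_of_real q"
    by (rule poly_eqI) (simp add: coeff_map_poly)
  then show ?thesis by simp
qed

lemma cpoly_pCons: "cpoly (pCons c q) z = complex_of_real c + z * cpoly q z"
  by (simp add: map_poly_pCons)

lemma cpoly_smult: "cpoly (smult c q) z = complex_of_real c * cpoly q z"
  by (simp add: map_poly_smult)

lemma cpoly_mult: "cpoly (p * q) z = cpoly p z * cpoly q z"
  by (induction p) (simp_all add: cpoly_add cpoly_smult cpoly_pCons algebra_simps)

lemma cpoly_minus: "cpoly (- p) z = - cpoly p z"
  using cpoly_smult[of "-1" p z] by simp

lemma cpoly_sum: "cpoly (\<Sum>i\<in>I. f i) z = (\<Sum>i\<in>I. cpoly (f i) z)"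
  by (induction I rule: infinite_finite_induct) (simp_all add: cpoly_add)

lemma cpoly_prod: "cpoly (\<Prod>i\<in>I. f i) z = (\<Prod>i\<in>I. cpoly (f i) z)"
  by (induction I rule: infinite_finite_induct) (simp_all add: cpoly_mult)

lemma cpoly_of_int: "cpoly (of_int n) z = of_int n"
  by (simp add: of_int_poly map_poly_pCons)

lemma cpoly_det: "cpoly (det A) z = det (\<chi> i k. cpoly (A $ i $ k) z)"
  by (simp add: det_def cpoly_sum cpoly_mult cpoly_prod cpoly_of_int)

lemma cpoly_monom: "cpoly (monom c n) z = complex_of_real c * z ^ n"
  by (simp add: map_poly_monom poly_monom)

text \<open>Any bound \<open>n\<close> works, so a single one can serve all parameter
  values.\<close>

lemma cpoly_conv_sum:
  assumes "\<And>k. k \<ge> n \<Longrightarrow> coeff q k = 0"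
  shows "cpoly q z = (\<Sum>k<n. complex_of_real (coeff q k) * z ^ k)"
proof -
  have "q = (\<Sum>k<n. monom (coeff q k) k)"
    by (rule poly_eqI) (use assms in \<open>force simp: coeff_sum\<close>)
  then have "cpoly q z = cpoly (\<Sum>k<n. monom (coeff q k) k) z" by metis
  then show ?thesis by (simp add: cpoly_sum cpoly_monom)
qed

lemma cpoly_has_root:
  assumes "degree q > 0"
  shows "\<exists>z. cpoly q z = 0"
  using assms alg_closed_imp_poly_has_root[of "map_poly complex_of_real q"]
  by (simp add: degree_map_poly)

lemma cpoly_roots_finite:
  assumes "q \<noteq> 0"
  shows "finite {z. cpoly q z = 0}"
  by (rule poly_roots_finite) (use assms in \<open>simp add: map_poly_eq_0_iff\<close>)

text \<open>Turns the points where the rank drops into the common roots of the minors.\<close>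

lemma minor_eval_matrix: "minor (eval_matrix M z) \<sigma> = cpoly (minor M \<sigma>) z"
  by (simp add: minor_def eval_matrix_def map_matrix_def cpoly_det)

section \<open>Polynomial functions\<close>

text \<open>Polynomials are handled as functions, so that closure properties follow by induction.
  Over the reals nothing is lost: a nonzero formal polynomial is a nonzero function.\<close>

inductive polyfun :: "'x set \<Rightarrow> (('x \<Rightarrow> real) \<Rightarrow> real) \<Rightarrow> bool" for X where
  polyfun_const: "polyfun X (\<lambda>a. c)"
| polyfun_var: "x \<in> X \<Longrightarrow> polyfun X (\<lambda>a. a x)"
| polyfun_add: "polyfun X F \<Longrightarrow> polyfun X G \<Longrightarrow> polyfun X (\<lambda>a. F a + G a)"
| polyfun_mult: "polyfun X F \<Longrightarrow> polyfun X G \<Longrightarrow> polyfun X (\<lambda>a. F a * G a)"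

lemma polyfun_sum: "(\<And>i. i \<in> I \<Longrightarrow> polyfun X (F i)) \<Longrightarrow> polyfun X (\<lambda>a. \<Sum>i\<in>I. F i a)"
  by (induction I rule: infinite_finite_induct) (auto intro: polyfun.intros)

lemma polyfun_prod: "(\<And>i. i \<in> I \<Longrightarrow> polyfun X (F i)) \<Longrightarrow> polyfun X (\<lambda>a. \<Prod>i\<in>I. F i a)"
  by (induction I rule: infinite_finite_induct) (auto intro: polyfun.intros)

lemma polyfun_power: "polyfun X F \<Longrightarrow> polyfun X (\<lambda>a. F a ^ n)"
  by (induction n) (auto intro: polyfun.intros)

lemma polyfun_mono: "polyfun X F \<Longrightarrow> X \<subseteq> Y \<Longrightarrow> polyfun Y F"
  by (induction rule: polyfun.induct) (auto intro: polyfun.intros)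

text \<open>Points may thus be arbitrary functions, and restricting them to the parameter set
  changes no value.\<close>

lemma polyfun_cong: "polyfun X F \<Longrightarrow> (\<And>x. x \<in> X \<Longrightarrow> a x = b x) \<Longrightarrow> F a = F b"
  by (induction rule: polyfun.induct) auto

lemma polyfun_substitute:
  "polyfun X F \<Longrightarrow> polyfun X (\<lambda>a. F (\<lambda>x. if Q x then c x else a x))"
proof (induction rule: polyfun.induct)
  case (polyfun_var x)
  then show ?case by (cases "Q x") (auto intro: polyfun.intros)
qed (auto intro: polyfun.intros)

lemma polyfun_on_line:
  "polyfun X F \<Longrightarrow> \<exists>q. \<forall>t. F (\<lambda>x. a x + t * b x) = poly q t"
proof (induction rule: polyfun.induct)
  case (polyfun_const c)
  show ?case by (rule exI[of _ "[:c:]"]) simp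
next
  case (polyfun_var x)
  show ?case by (rule exI[of _ "[:a x, b x:]"]) simp
next
  case (polyfun_add F G)
  then show ?case by (metis poly_add)
next
  case (polyfun_mult F G)
  then show ?case by (metis poly_mult)
qed

text \<open>On a line the function is a univariate polynomial. This serves as the density argument
  throughout.\<close>

lemma polyfun_zeros_on_line:
  assumes "polyfun X F" and "F (\<lambda>x. a x + t0 * b x) \<noteq> 0"
  shows "finite {t. F (\<lambda>x. a x + t * b x) = 0}"
proof -
  obtain q where "\<And>t. F (\<lambda>x. a x + t * b x) = poly q t"
    using polyfun_on_line[OF assms(1), of a b] by blast
  moreover from this have "q \<noteq> 0" using assms(2) by auto
  ultimately show ?thesis by (simp add: poly_roots_finite)
qed

section \<open>Polynomial functions that do not vanish identically\<close>

definition nonzero :: "('b \<Rightarrow> real) \<Rightarrow> bool" where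
  "nonzero F \<longleftrightarrow> (\<exists>a. F a \<noteq> 0)"

text \<open>Join a nonzero point of \<open>F\<close> to one of \<open>G\<close> by a line; each
  function has finitely many zeros on it, so a point outside both zero sets remains.\<close>

lemma nonzero_mult:
  assumes "polyfun X F" "polyfun X G" "nonzero F" "nonzero G"
  shows "nonzero (\<lambda>a. F a * G a)"
proof -
  obtain a b where a: "F a \<noteq> 0" and b: "G b \<noteq> 0" using assms(3,4) by (auto simp: nonzero_def)
  let ?l = "\<lambda>t x. a x + t * (b x - a x)"
  have "finite {t. F (?l t) = 0}" by (rule polyfun_zeros_on_line[OF assms(1), of _ 0]) (simp add: a)
  moreover have "finite {t. G (?l t) = 0}"
    by (rule polyfun_zeros_on_line[OF assms(2), of _ 1]) (simp add: b)
  ultimately have "finite ({t. F (?l t) = 0} \<union> {t. G (?l t) = 0})" by simp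
  then obtain t where "t \<notin> {t. F (?l t) = 0} \<union> {t. G (?l t) = 0}"
    using ex_new_if_finite[OF infinite_UNIV_char_0] by blast
  then show ?thesis by (auto simp: nonzero_def intro!: exI[of _ "?l t"])
qed

lemma nonzero_prod:
  assumes "finite I" "\<And>i. i \<in> I \<Longrightarrow> polyfun X (F i)" "\<And>i. i \<in> I \<Longrightarrow> nonzero (F i)"
  shows "nonzero (\<lambda>a. \<Prod>i\<in>I. F i a)"
  using assms
proof (induction I rule: finite_induct)
  case empty
  show ?case by (simp add: nonzero_def)
next
  case (insert i I)
  then have "nonzero (\<lambda>a. F i a * (\<Prod>i\<in>I. F i a))"
    by (intro nonzero_mult[where X = X] polyfun_prod) auto
  then show ?case using insert.hyps by simp
qed


subsection \<open>Evaluation of multivariate polynomials\<close>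

definition monom_eval :: "('x \<Rightarrow>\<^sub>0 nat) \<Rightarrow> ('x \<Rightarrow> 'a) \<Rightarrow> 'a::comm_semiring_1" where
  "monom_eval m a = (\<Prod>x\<in>Poly_Mapping.keys m. a x ^ Poly_Mapping.lookup m x)"

lemma monom_eval_superset:
  assumes "finite X" "Poly_Mapping.keys m \<subseteq> X"
  shows "monom_eval m a = (\<Prod>x\<in>X. a x ^ Poly_Mapping.lookup m x)"
  unfolding monom_eval_def
  by (rule prod.mono_neutral_left) (use assms in \<open>auto simp: in_keys_iff\<close>)

lemma monom_eval_add: "monom_eval (m + m') a = monom_eval m a * monom_eval m' a"
proof -
  let ?X = "Poly_Mapping.keys m \<union> Poly_Mapping.keys m'"
  have "monom_eval (m + m') a = (\<Prod>x\<in>?X. a x ^ Poly_Mapping.lookup (m + m') x)"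
    by (rule monom_eval_superset) (auto dest: set_mp[OF keys_add])
  then show ?thesis
    by (simp add: monom_eval_superset[of ?X] lookup_add power_add prod.distrib)
qed

lemma multi_eval_eq: "multi_eval f a = (\<Sum>m\<in>Poly_Mapping.keys f. Poly_Mapping.lookup f m * monom_eval m a)"
  by (simp add: multi_eval_def monom_eval_def)

lemma multi_eval_superset:
  assumes "finite A" "Poly_Mapping.keys f \<subseteq> A"
  shows "multi_eval f a = (\<Sum>m\<in>A. Poly_Mapping.lookup f m * monom_eval m a)"
  unfolding multi_eval_eq
  by (rule sum.mono_neutral_left) (use assms in \<open>auto simp: in_keys_iff\<close>)

lemma multi_eval_add: "multi_eval (f + g) a = multi_eval f a + multi_eval g a"
proof -
  let ?A = "Poly_Mapping.keys f \<union> Poly_Mapping.keys g"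
  have "multi_eval (f + g) a = (\<Sum>m\<in>?A. Poly_Mapping.lookup (f + g) m * monom_eval m a)"
    by (rule multi_eval_superset) (auto dest: set_mp[OF keys_add])
  then show ?thesis
    by (simp add: multi_eval_superset[of ?A] lookup_add distrib_right sum.distrib)
qed

lemma multi_eval_single: "multi_eval (Poly_Mapping.single m c) a = c * monom_eval m a"
  by (simp add: multi_eval_eq)

lemma multi_vars_add: "multi_vars (f + g) \<subseteq> multi_vars f \<union> multi_vars g"
  using keys_add[of f g] by (auto simp: multi_vars_def)

lemma multi_vars_single: "multi_vars (Poly_Mapping.single m c) \<subseteq> Poly_Mapping.keys m"
  by (simp add: multi_vars_def)

text \<open>Products are expanded on lists of coefficient-monomial pairs, which reduces their
  evaluation to the additivity of exponents.\<close>

definition term_mult ::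
    "(real \<times> ('x \<Rightarrow>\<^sub>0 nat)) \<times> (real \<times> ('x \<Rightarrow>\<^sub>0 nat)) \<Rightarrow> real \<times> ('x \<Rightarrow>\<^sub>0 nat)" where
  "term_mult = (\<lambda>((c, m), (c', m')). (c * c', m + m'))"

lemma sum_list_term_mult:
  "(\<Sum>(c', m')\<leftarrow>map term_mult (map (Pair (c, m)) L). c' * monom_eval m' a) =
    c * monom_eval m a * (\<Sum>(c', m')\<leftarrow>L. c' * monom_eval m' a)"
  by (induction L) (auto simp: term_mult_def monom_eval_add algebra_simps)

lemma polyfun_conv_sum_list:
  assumes "polyfun X F"
  shows "\<exists>L. (\<forall>(c, m)\<in>set L. Poly_Mapping.keys m \<subseteq> X) \<and>
    (\<forall>a. F a = (\<Sum>(c, m)\<leftarrow>L. c * monom_eval m a))"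
  using assms
proof (induction rule: polyfun.induct)
  case (polyfun_const c)
  show ?case by (rule exI[of _ "[(c, 0)]"]) (simp add: monom_eval_def)
next
  case (polyfun_var x)
  then show ?case
    by (intro exI[of _ "[(1, Poly_Mapping.single x 1)]"]) (simp add: monom_eval_def)
next
  case (polyfun_add F G)
  then obtain L L' where
    "\<forall>(c, m)\<in>set L. Poly_Mapping.keys m \<subseteq> X" "\<And>a. F a = (\<Sum>(c, m)\<leftarrow>L. c * monom_eval m a)"
    "\<forall>(c, m)\<in>set L'. Poly_Mapping.keys m \<subseteq> X" "\<And>a. G a = (\<Sum>(c, m)\<leftarrow>L'. c * monom_eval m a)"
    by blast
  then show ?case by (intro exI[of _ "L @ L'"]) auto
next
  case (polyfun_mult F G)
  then obtain L L' where L: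
    "\<forall>(c, m)\<in>set L. Poly_Mapping.keys m \<subseteq> X" "\<And>a. F a = (\<Sum>(c, m)\<leftarrow>L. c * monom_eval m a)"
    "\<forall>(c, m)\<in>set L'. Poly_Mapping.keys m \<subseteq> X" "\<And>a. G a = (\<Sum>(c, m)\<leftarrow>L'. c * monom_eval m a)"
    by blast
  have "(\<Sum>(c, m)\<leftarrow>map term_mult (List.product L L'). c * monom_eval m a) =
      (\<Sum>(c, m)\<leftarrow>L. c * monom_eval m a) * (\<Sum>(c, m)\<leftarrow>L'. c * monom_eval m a)" for a
  proof (induction L)
    case Nil
    show ?case by simp
  next
    case (Cons y L)
    obtain c m where y: "y = (c, m)" by (cases y)
    show ?case using Cons by (simp add: y distrib_right sum_list_term_mult del: map_map)
  qed
  moreover have "\<forall>(c, m)\<in>set (map term_mult (List.product L L')). Poly_Mapping.keys m \<subseteq> X"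
    using L(1,3) by (fastforce simp: term_mult_def dest!: set_mp[OF keys_add])
  ultimately show ?case using L(2,4) by (intro exI[of _ "map term_mult (List.product L L')"]) metis
qed

text \<open>Adding the listed terms one by one collects equal monomials into a formal
  polynomial.\<close>

lemma polyfun_imp_multi_eval:
  assumes "polyfun X F"
  shows "\<exists>f. multi_vars f \<subseteq> X \<and> multi_eval f = F"
proof -
  obtain L where L: "\<forall>(c, m)\<in>set L. Poly_Mapping.keys m \<subseteq> X"
      "\<And>a. F a = (\<Sum>(c, m)\<leftarrow>L. c * monom_eval m a)"
    using polyfun_conv_sum_list[OF assms] by blast
  have "\<exists>f. multi_vars f \<subseteq> X \<and> (\<forall>a. multi_eval f a = (\<Sum>(c, m)\<leftarrow>L. c * monom_eval m a))"
    using L(1)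
  proof (induction L)
    case Nil
    show ?case by (rule exI[of _ 0]) (simp add: multi_vars_def multi_eval_def)
  next
    case (Cons y L)
    obtain c m where y: "y = (c, m)" by (cases y)
    obtain f where f: "multi_vars f \<subseteq> X" "\<And>a. multi_eval f a = (\<Sum>(c, m)\<leftarrow>L. c * monom_eval m a)"
      using Cons by auto
    have "multi_vars (Poly_Mapping.single m c + f) \<subseteq> X"
      using multi_vars_add[of "Poly_Mapping.single m c" f] multi_vars_single[of m c] f(1) Cons.prems
      by (auto simp: y)
    then show ?case
      by (intro exI[of _ "Poly_Mapping.single m c + f"])
        (simp add: multi_eval_add multi_eval_single f(2) y)
  qed
  then show ?thesis using L(2) by (metis ext)
qed

lemma polyfun_multi_eval: "polyfun (multi_vars f) (multi_eval f)"
proof -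
  have "polyfun (multi_vars f) (\<lambda>a. multi_eval f a)"
    unfolding multi_eval_def
    by (intro polyfun_sum polyfun_mult polyfun_const polyfun_prod polyfun_power polyfun_var)
      (auto simp: multi_vars_def)
  then show ?thesis by simp
qed

text \<open>The injectivity hypothesis, instead of exponents supported on \<open>X\<close>, lets the induction
  fix the exponent of one variable without changing the monomials.\<close>

lemma sum_monomials_nonzero:
  fixes c :: "('x \<Rightarrow> nat) \<Rightarrow> real"
  assumes "finite X" "finite S" "S \<noteq> {}" "\<And>m. m \<in> S \<Longrightarrow> c m \<noteq> 0"
    and "\<And>m m'. \<lbrakk>m \<in> S; m' \<in> S; \<forall>x\<in>X. m x = m' x\<rbrakk> \<Longrightarrow> m = m'"
  shows "\<exists>a. (\<Sum>m\<in>S. c m * (\<Prod>x\<in>X. a x ^ m x)) \<noteq> 0"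
  using assms
proof (induction X arbitrary: S rule: finite_induct)
  case empty
  then obtain m where "S = {m}" by blast
  then show ?case using empty by simp
next
  case (insert y X)
  obtain m0 where m0: "m0 \<in> S" using insert.prems by blast
  let ?S = "{m \<in> S. m y = m0 y}"
  have "\<exists>a. (\<Sum>m\<in>?S. c m * (\<Prod>x\<in>X. a x ^ m x)) \<noteq> 0"
    by (rule insert.IH) (use insert.prems m0 in auto)
  then obtain a where a: "(\<Sum>m\<in>?S. c m * (\<Prod>x\<in>X. a x ^ m x)) \<noteq> 0" by blast
  \<comment> \<open>Orders the sum by powers of the value of \<open>y\<close>; the coefficient at
    \<open>m0 y\<close> is the sum over \<open>?S\<close>, nonzero by the choice of
    \<open>a\<close>.\<close>
  define q where "q = (\<Sum>m\<in>S. monom (c m * (\<Prod>x\<in>X. a x ^ m x)) (m y))"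
  have "coeff q (m0 y) = (\<Sum>m\<in>?S. c m * (\<Prod>x\<in>X. a x ^ m x))"
    unfolding q_def coeff_sum sum.inter_filter[OF insert.prems(1)]
    by (rule sum.cong) auto
  then have "q \<noteq> 0" using a by auto
  then obtain t where t: "poly q t \<noteq> 0" using poly_all_0_iff_0 by blast
  have "(\<Prod>x\<in>insert y X. (a(y := t)) x ^ m x) = (\<Prod>x\<in>X. a x ^ m x) * t ^ m y" for m
  proof -
    have "(\<Prod>x\<in>X. (a(y := t)) x ^ m x) = (\<Prod>x\<in>X. a x ^ m x)"
      by (rule prod.cong) (use insert.hyps in auto)
    then show ?thesis using insert.hyps by simp
  qed
  then have "(\<Sum>m\<in>S. c m * (\<Prod>x\<in>insert y X. (a(y := t)) x ^ m x)) = poly q t"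
    by (simp add: q_def poly_sum poly_monom mult.assoc)
  then show ?case using t by metis
qed

text \<open>Monomials become plain exponent functions through the injective \<open>lookup\<close>.
  Their exponents vanish outside \<open>multi_vars f\<close>, so distinct ones already differ there,
  as \<open>sum_monomials_nonzero\<close> requires.\<close>

lemma nonzero_multi_eval:
  fixes f :: "('x, real) multi_poly"
  assumes "f \<noteq> 0"
  shows "nonzero (multi_eval f)"
proof -
  let ?X = "multi_vars f"
  have finX: "finite ?X" by (simp add: multi_vars_def)
  have inj: "inj (Poly_Mapping.lookup :: ('x \<Rightarrow>\<^sub>0 nat) \<Rightarrow> 'x \<Rightarrow> nat)"
    by (rule injI) (rule poly_mapping_eqI, simp)
  let ?S = "Poly_Mapping.lookup ` Poly_Mapping.keys f"
  let ?c = "\<lambda>m. Poly_Mapping.lookup f (inv Poly_Mapping.lookup m)"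
  have "\<exists>a. (\<Sum>m\<in>?S. ?c m * (\<Prod>x\<in>?X. a x ^ m x)) \<noteq> 0"
  proof (rule sum_monomials_nonzero)
    show "?S \<noteq> {}" using assms by simp
    show "?c m \<noteq> 0" if "m \<in> ?S" for m
      using that by (auto simp: inv_f_f[OF inj] in_keys_iff)
    show "m = m'" if mm': "m \<in> ?S" "m' \<in> ?S" "\<forall>x\<in>?X. m x = m' x" for m m'
    proof
      fix x
      show "m x = m' x"
      proof (cases "x \<in> ?X")
        case False
        then have "m x = 0" "m' x = 0"
          using mm'(1,2) by (auto simp: multi_vars_def in_keys_iff)
        then show ?thesis by simp
      qed (use mm' in blast)
    qed
  qed (use finX in auto)
  then obtain a where a: "(\<Sum>m\<in>?S. ?c m * (\<Prod>x\<in>?X. a x ^ m x)) \<noteq> 0" by blast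
  have "(\<Sum>m\<in>?S. ?c m * (\<Prod>x\<in>?X. a x ^ m x)) =
      (\<Sum>m\<in>Poly_Mapping.keys f. Poly_Mapping.lookup f m * monom_eval m a)"
    by (subst sum.reindex)
      (auto intro!: sum.cong inj_on_subset[OF inj] monom_eval_superset[symmetric]
        simp: inv_f_f[OF inj] finX multi_vars_def)
  then show ?thesis using a by (auto simp: nonzero_def multi_eval_eq)
qed

text \<open>Lets polynomial functions witness genericity; \<open>Q\<close> stands for whatever is
  asked of the values.\<close>

lemma ex_multi_poly_iff_polyfun:
  "(\<exists>f :: ('x, real) multi_poly. f \<noteq> 0 \<and> multi_vars f \<subseteq> X \<and> Q (multi_eval f)) \<longleftrightarrow>
   (\<exists>F. polyfun X F \<and> nonzero F \<and> Q F)"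
proof
  assume "\<exists>f :: ('x, real) multi_poly. f \<noteq> 0 \<and> multi_vars f \<subseteq> X \<and> Q (multi_eval f)"
  then show "\<exists>F. polyfun X F \<and> nonzero F \<and> Q F"
    using nonzero_multi_eval polyfun_mono polyfun_multi_eval by blast
next
  assume "\<exists>F. polyfun X F \<and> nonzero F \<and> Q F"
  then obtain F where F: "polyfun X F" "nonzero F" "Q F" by blast
  obtain f where f: "multi_vars f \<subseteq> X" "multi_eval f = F"
    using polyfun_imp_multi_eval[OF F(1)] by blast
  have "f \<noteq> 0"
    using F(2) f(2) by (auto simp: nonzero_def multi_eval_def)
  then show "\<exists>f :: ('x, real) multi_poly. f \<noteq> 0 \<and> multi_vars f \<subseteq> X \<and> Q (multi_eval f)"
    using f F(3) by blast
qed

section \<open>Polynomials with generic coefficients\<close>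

text \<open>A polynomial whose coefficients are polynomial functions of the parameters.
  \<open>n\<close> bounds the number of coefficients uniformly, and \<open>n = 0\<close> means the
  zero polynomial, which gives Euclid's algorithm a plain induction measure.\<close>

definition ppoly_below :: "'x set \<Rightarrow> nat \<Rightarrow> (('x \<Rightarrow> real) \<Rightarrow> real poly) \<Rightarrow> bool" where
  "ppoly_below X n U \<longleftrightarrow> (\<forall>k. polyfun X (\<lambda>a. coeff (U a) k)) \<and> (\<forall>a. \<forall>k\<ge>n. coeff (U a) k = 0)"

definition ppoly :: "'x set \<Rightarrow> (('x \<Rightarrow> real) \<Rightarrow> real poly) \<Rightarrow> bool" where
  "ppoly X U \<longleftrightarrow> (\<exists>n. ppoly_below X n U)"

lemma ppoly_coeff: "ppoly X U \<Longrightarrow> polyfun X (\<lambda>a. coeff (U a) k)"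
  by (auto simp: ppoly_def ppoly_below_def)

lemma ppoly_const: "ppoly X (\<lambda>a. p)"
  unfolding ppoly_def ppoly_below_def
  by (intro exI[of _ "Suc (degree p)"]) (auto intro: polyfun_const coeff_eq_0)

lemma ppoly_monom: "polyfun X F \<Longrightarrow> ppoly X (\<lambda>a. monom (F a) k)"
  unfolding ppoly_def ppoly_below_def
proof (intro exI[of _ "Suc k"] conjI allI impI)
  fix l
  assume "polyfun X F"
  then show "polyfun X (\<lambda>a. coeff (monom (F a) k) l)"
    by (cases "k = l") (auto intro: polyfun_const)
qed simp

lemma ppoly_add:
  assumes "ppoly X U" "ppoly X W"
  shows "ppoly X (\<lambda>a. U a + W a)"
proof -
  obtain n m where nm: "ppoly_below X n U" "ppoly_below X m W" using assms by (auto simp: ppoly_def)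
  then have "ppoly_below X (max n m) (\<lambda>a. U a + W a)"
    by (auto simp: ppoly_below_def intro: polyfun_add)
  then show ?thesis by (auto simp: ppoly_def)
qed

lemma ppoly_mult:
  assumes "ppoly X U" "ppoly X W"
  shows "ppoly X (\<lambda>a. U a * W a)"
proof -
  obtain n m where n: "ppoly_below X n U" and m: "ppoly_below X m W"
    using assms by (auto simp: ppoly_def)
  have "coeff (U a * W a) k = 0" if "k \<ge> n + m" for a k
    unfolding coeff_mult
  proof (rule sum.neutral, safe)
    fix i assume "i \<le> k"
    then have "i \<ge> n \<or> k - i \<ge> m" using that by linarith
    then show "coeff (U a) i * coeff (W a) (k - i) = 0"
      using n m by (auto simp: ppoly_below_def)
  qed
  moreover have "polyfun X (\<lambda>a. coeff (U a * W a) k)" for k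
    unfolding coeff_mult using n m
    by (intro polyfun_sum polyfun_mult) (auto simp: ppoly_below_def)
  ultimately have "ppoly_below X (n + m) (\<lambda>a. U a * W a)" by (auto simp: ppoly_below_def)
  then show ?thesis by (auto simp: ppoly_def)
qed

lemma ppoly_sum: "(\<And>i. i \<in> I \<Longrightarrow> ppoly X (U i)) \<Longrightarrow> ppoly X (\<lambda>a. \<Sum>i\<in>I. U i a)"
  by (induction I rule: infinite_finite_induct) (auto intro: ppoly_const ppoly_add)

lemma ppoly_prod: "(\<And>i. i \<in> I \<Longrightarrow> ppoly X (U i)) \<Longrightarrow> ppoly X (\<lambda>a. \<Prod>i\<in>I. U i a)"
  by (induction I rule: infinite_finite_induct) (auto intro: ppoly_const ppoly_mult)

lemma ppoly_det:
  fixes A :: "('x \<Rightarrow> real) \<Rightarrow> real poly ^ 'n ^ 'n"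
  assumes "\<And>i k. ppoly X (\<lambda>a. A a $ i $ k)"
  shows "ppoly X (\<lambda>a. det (A a))"
  unfolding det_def by (intro ppoly_sum ppoly_mult ppoly_const ppoly_prod assms)

text \<open>For fixed \<open>z\<close> the real and imaginary parts of the value are polynomial
  functions of the parameters, so infinitely many zeros on a line make both vanish on the whole
  line.\<close>

lemma cpoly_zeros_on_line:
  assumes U: "ppoly X U" and T: "infinite T"
    and zero: "\<And>t. t \<in> T \<Longrightarrow> cpoly (U (\<lambda>x. a x + t * b x)) z = 0"
  shows "cpoly (U (\<lambda>x. a x + t * b x)) z = 0"
proof -
  obtain n where n: "ppoly_below X n U" using U by (auto simp: ppoly_def)
  define F where "F = (\<lambda>\<phi> a. \<Sum>k<n. coeff (U a) k * \<phi> (z ^ k))"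
  have polyfun: "polyfun X (F \<phi>)" for \<phi>
    unfolding F_def by (intro polyfun_sum polyfun_mult polyfun_const ppoly_coeff[OF U])
  have eq: "cpoly (U a) z = (\<Sum>k<n. complex_of_real (coeff (U a) k) * z ^ k)" for a
    by (rule cpoly_conv_sum) (use n in \<open>simp add: ppoly_below_def\<close>)
  have "Re (cpoly (U a) z) = F Re a" "Im (cpoly (U a) z) = F Im a" for a
    unfolding eq F_def by simp_all
  then have iff: "cpoly (U a) z = 0 \<longleftrightarrow> F Re a = 0 \<and> F Im a = 0" for a
    by (metis complex_eq_iff zero_complex.simps)
  have "F \<phi> (\<lambda>x. a x + t * b x) = 0" if "\<phi> = Re \<or> \<phi> = Im" for \<phi>
  proof (rule ccontr)
    assume "F \<phi> (\<lambda>x. a x + t * b x) \<noteq> 0"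
    then have "finite {t. F \<phi> (\<lambda>x. a x + t * b x) = 0}"
      by (rule polyfun_zeros_on_line[OF polyfun])
    moreover have "T \<subseteq> {t. F \<phi> (\<lambda>x. a x + t * b x) = 0}"
      using zero that by (auto simp: iff)
    ultimately show False using T finite_subset by blast
  qed
  then show ?thesis by (simp add: iff)
qed

text \<open>Euclid's algorithm with pseudo-division, where a leading coefficient is inverted as soon as
  it is a nonzero polynomial function.\<close>

lemma generic_gcd:
  assumes "ppoly_below X n U" "ppoly_below X m W"
  shows "\<exists>h G. polyfun X h \<and> nonzero h \<and> ppoly X G \<and>
    (\<forall>a z. h a \<noteq> 0 \<longrightarrow> (cpoly (U a) z = 0 \<and> cpoly (W a) z = 0 \<longleftrightarrow> cpoly (G a) z = 0))"
  using assms
proof (induction "n + m" arbitrary: n m U W rule: less_induct)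
  case less
  let ?goal = "\<lambda>U W. \<exists>h G. polyfun X h \<and> nonzero h \<and> ppoly X G \<and>
    (\<forall>a z. h a \<noteq> 0 \<longrightarrow> (cpoly (U a) z = 0 \<and> cpoly (W a) z = 0 \<longleftrightarrow> cpoly (G a) z = 0))"
  have sym: "?goal U W \<longleftrightarrow> ?goal W U" for U W by (simp add: conj_commute)
  have vanish: "?goal U W" if "ppoly_below X 0 U" "ppoly_below X m W" for U W m
  proof -
    have "U a = 0" for a using that by (intro poly_eqI) (auto simp: ppoly_below_def)
    then show ?thesis
      using that by (intro exI[of _ "\<lambda>_. 1"] exI[of _ W])
        (auto simp: nonzero_def ppoly_def intro: polyfun_const)
  qed
  have reduce: "?goal U W"
    if nm: "n' \<le> m'" "n' + m' \<le> n + m" and U: "ppoly_below X (Suc n') U"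
      and W: "ppoly_below X (Suc m') W" and lead: "nonzero (\<lambda>a. coeff (U a) n')"
      and less_nm: "Suc n' + m' < n + m"
    for U W n' m'
  proof -
    let ?c = "\<lambda>a. coeff (U a) n'"
    \<comment> \<open>One step of pseudo-division: the terms of degree \<open>m'\<close> cancel, and
      where \<open>?c\<close> is nonzero the pairs \<open>U\<close>, \<open>W\<close> and
      \<open>U\<close>, \<open>W'\<close> have the same common roots.\<close>
    define W' where "W' = (\<lambda>a. smult (?c a) (W a) + - (monom (coeff (W a) m') (m' - n') * U a))"
    have poly_c: "polyfun X ?c" using U by (simp add: ppoly_below_def)
    have UW: "ppoly X U" "ppoly X W" using U W by (auto simp: ppoly_def)
    have "ppoly X (\<lambda>a. monom (?c a) 0 * W a + monom (-1) 0 * (monom (coeff (W a) m') (m' - n') * U a))"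
      by (intro ppoly_add ppoly_mult ppoly_monom polyfun_const ppoly_coeff UW)
    then have ppW': "ppoly X W'" by (simp add: W'_def monom_0)
    have "coeff (W' a) k = 0" if k: "k \<ge> m'" for a k
    proof (cases "k = m'")
      case True
      then show ?thesis using nm by (simp add: W'_def coeff_monom_mult)
    next
      case False
      then have "coeff (W a) k = 0" "coeff (U a) (k - (m' - n')) = 0"
        using U W k nm by (auto simp: ppoly_below_def)
      then show ?thesis by (simp add: W'_def coeff_monom_mult)
    qed
    then have "ppoly_below X m' W'" using ppW' by (simp add: ppoly_below_def ppoly_coeff)
    from less.hyps[OF less_nm U this] obtain h G where
      h: "polyfun X h" "nonzero h" "ppoly X G"
      "\<And>a z. h a \<noteq> 0 \<Longrightarrow> cpoly (U a) z = 0 \<and> cpoly (W' a) z = 0 \<longleftrightarrow> cpoly (G a) z = 0"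
      by blast
    have "cpoly (W' a) z = complex_of_real (?c a) * cpoly (W a) z -
        cpoly (monom (coeff (W a) m') (m' - n')) z * cpoly (U a) z" for a z
      unfolding W'_def cpoly_add cpoly_minus cpoly_mult cpoly_smult by simp
    then have "h a * ?c a \<noteq> 0 \<Longrightarrow>
        cpoly (U a) z = 0 \<and> cpoly (W a) z = 0 \<longleftrightarrow> cpoly (G a) z = 0" for a z
      using h(4)[of a z] by auto
    moreover have "polyfun X (\<lambda>a. h a * ?c a)" "nonzero (\<lambda>a. h a * ?c a)"
      using h poly_c lead by (auto intro: polyfun_mult nonzero_mult)
    ultimately show ?thesis using h(3)
      by (intro exI[of _ "\<lambda>a. h a * ?c a"] exI[of _ G]) blast
  qed
  \<comment> \<open>A top coefficient that vanishes identically only means that the bound was too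
    large.\<close>
  have shrink: "ppoly_below X n' U" if "ppoly_below X (Suc n') U" "\<not> nonzero (\<lambda>a. coeff (U a) n')" for n' U
    using that unfolding ppoly_below_def nonzero_def by (metis le_antisym not_less_eq_eq)
  show ?case
  proof (cases n)
    case 0
    then show ?thesis using vanish less.prems by blast
  next
    case n: (Suc n')
    show ?thesis
    proof (cases m)
      case 0
      then show ?thesis using vanish less.prems sym by blast
    next
      case m: (Suc m')
      consider "\<not> nonzero (\<lambda>a. coeff (U a) n')" | "\<not> nonzero (\<lambda>a. coeff (W a) m')"
        | "nonzero (\<lambda>a. coeff (U a) n')" "nonzero (\<lambda>a. coeff (W a) m')" by blast
      then show ?thesis
      proof cases
        case 1
        then show ?thesis using less.hyps[of n' m U W] less.prems shrink n by simp
      next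
        case 2
        then show ?thesis using less.hyps[of n m' U W] less.prems shrink m by simp
      next
        case 3
        show ?thesis
        proof (cases "n' \<le> m'")
          case True
          then show ?thesis using reduce[of n' m' U W] 3 less.prems n m by simp
        next
          case False
          then have "?goal W U" using reduce[of m' n' W U] 3 less.prems n m by simp
          then show ?thesis unfolding sym[of U W] .
        qed
      qed
    qed
  qed
qed

text \<open>Fold the pairwise step over the family, multiplying the exceptional polynomials. The
  empty family starts with the zero polynomial, of which every point is a root.\<close>

lemma generic_Gcd:
  assumes "finite I" "\<And>i. i \<in> I \<Longrightarrow> ppoly X (U i)"
  shows "\<exists>h G. polyfun X h \<and> nonzero h \<and> ppoly X G \<and>
    (\<forall>a z. h a \<noteq> 0 \<longrightarrow> ((\<forall>i\<in>I. cpoly (U i a) z = 0) \<longleftrightarrow> cpoly (G a) z = 0))"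
  using assms
proof (induction I rule: finite_induct)
  case empty
  show ?case
    by (intro exI[of _ "\<lambda>_. 1"] exI[of _ "\<lambda>_. 0"])
      (simp add: nonzero_def polyfun_const ppoly_const)
next
  case (insert i I)
  then obtain h G where h: "polyfun X h" "nonzero h" "ppoly X G"
    "\<And>a z. h a \<noteq> 0 \<Longrightarrow> (\<forall>i\<in>I. cpoly (U i a) z = 0) \<longleftrightarrow> cpoly (G a) z = 0"
    by auto
  obtain n m where "ppoly_below X n (U i)" "ppoly_below X m G"
    using insert.prems[of i] h(3) by (auto simp: ppoly_def)
  from generic_gcd[OF this] obtain h' G' where h': "polyfun X h'" "nonzero h'" "ppoly X G'"
    "\<And>a z. h' a \<noteq> 0 \<Longrightarrow> cpoly (U i a) z = 0 \<and> cpoly (G a) z = 0 \<longleftrightarrow> cpoly (G' a) z = 0"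
    by blast
  show ?case
  proof (intro exI conjI allI impI)
    show "polyfun X (\<lambda>a. h a * h' a)" "nonzero (\<lambda>a. h a * h' a)" "ppoly X G'"
      using h h' by (auto intro: polyfun_mult nonzero_mult)
    fix a z assume "h a * h' a \<noteq> 0"
    then show "(\<forall>i\<in>insert i I. cpoly (U i a) z = 0) \<longleftrightarrow> cpoly (G' a) z = 0"
      using h(4)[of a z] h'(4)[of a z] by auto
  qed
qed

text \<open>If the gcd vanishes identically, every point is a common root. Otherwise it has constant
  degree outside a hypersurface: degree zero means no root, and positive degree gives a complex
  one.\<close>

lemma generic_root_dichotomy:
  assumes "finite I" "\<And>i. i \<in> I \<Longrightarrow> ppoly X (U i)"
  obtains (no_root) h where "polyfun X h" "nonzero h"
      "\<And>a z. h a \<noteq> 0 \<Longrightarrow> \<exists>i\<in>I. cpoly (U i a) z \<noteq> 0"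
  | (root) h where "polyfun X h" "nonzero h"
      "\<And>a. h a \<noteq> 0 \<Longrightarrow> \<exists>z. \<forall>i\<in>I. cpoly (U i a) z = 0"
proof -
  obtain h G where h: "polyfun X h" "nonzero h" "ppoly X G"
    "\<And>a z. h a \<noteq> 0 \<Longrightarrow> (\<forall>i\<in>I. cpoly (U i a) z = 0) \<longleftrightarrow> cpoly (G a) z = 0"
    using generic_Gcd[of I X U, OF assms] by blast
  obtain N where N: "ppoly_below X N G" using h(3) by (auto simp: ppoly_def)
  show ?thesis
  proof (cases "\<forall>k. \<not> nonzero (\<lambda>a. coeff (G a) k)")
    case True
    then have "G a = 0" for a by (intro poly_eqI) (simp add: nonzero_def)
    then show ?thesis using root[OF h(1,2)] h(4) by simp
  next
    case False
    define S where "S = {k. nonzero (\<lambda>a. coeff (G a) k)}"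
    have "S \<subseteq> {..<N}" using N by (force simp: S_def nonzero_def ppoly_below_def not_le[symmetric])
    then have fin: "finite S" and ne: "S \<noteq> {}" using False by (auto simp: S_def finite_subset)
    \<comment> \<open>The generic degree of \<open>G\<close>. The factor
      \<open>coeff (G a) n\<close> in \<open>?h\<close> excludes the points where the degree
      drops.\<close>
    define n where "n = Max S"
    have lead: "nonzero (\<lambda>a. coeff (G a) n)" using Max_in[OF fin ne] by (simp add: S_def n_def)
    have above: "coeff (G a) k = 0" if "k > n" for a k
      using that Max_ge[OF fin, of k] by (force simp: S_def n_def nonzero_def)
    let ?h = "\<lambda>a. h a * coeff (G a) n"
    have deg: "degree (G a) = n" if "?h a \<noteq> 0" for a
      by (intro antisym degree_le le_degree) (use above that in auto)
    have polyfun: "polyfun X ?h" "nonzero ?h"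
      using h lead by (auto intro: polyfun_mult nonzero_mult ppoly_coeff)
    show ?thesis
    proof (cases "n = 0")
      case True
      have "\<exists>i\<in>I. cpoly (U i a) z \<noteq> 0" if "?h a \<noteq> 0" for a z
      proof -
        have "cpoly (G a) z = complex_of_real (coeff (G a) 0)"
          using cpoly_conv_sum[of 1 "G a" z] above[of _ a] True by simp
        then show ?thesis using h(4)[of a z] that True by auto
      qed
      then show ?thesis using no_root[OF polyfun] by blast
    next
      case False
      have "\<exists>z. \<forall>i\<in>I. cpoly (U i a) z = 0" if "?h a \<noteq> 0" for a
        using cpoly_has_root[of "G a"] deg[OF that] False h(4)[of a] that by auto
      then show ?thesis using root[OF polyfun] by blast
    qed
  qed
qed

section \<open>Saturating matchings\<close>

text \<open>A row-saturating matching meets every row exactly once, so it is encoded by the function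
  from rows to their partners.\<close>

definition saturating :: "('p \<times> 'v) set \<Rightarrow> ('p \<Rightarrow> 'v) \<Rightarrow> bool" where
  "saturating E f \<longleftrightarrow> inj f \<and> (\<forall>i. (i, f i) \<in> E)"

lemma row_saturating_matching_iff:
  fixes E :: "('p::finite \<times> 'v::finite) set"
  shows "row_saturating_matching E F \<longleftrightarrow> (\<exists>f. saturating E f \<and> F = range (\<lambda>i. (i, f i)))"
proof
  assume F: "row_saturating_matching E F"
  then have inj: "inj_on fst F" and card: "card F = CARD('p)"
    by (auto simp: row_saturating_matching_def matching_def inj_on_def)
  have "fst ` F = UNIV"
    using card_image[OF inj] card by (intro card_subset_eq) auto
  then have "\<forall>i. \<exists>j. (i, j) \<in> F" by (metis UNIV_I fst_conv imageE surj_pair)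
  then obtain f where f: "\<And>i. (i, f i) \<in> F" by metis
  have "F = range (\<lambda>i. (i, f i))"
  proof safe
    fix i j assume "(i, j) \<in> F"
    then have "(i, j) = (i, f i)" using f[of i] by (intro inj_onD[OF inj]) simp_all
    then show "(i, j) \<in> range (\<lambda>i. (i, f i))" by simp
  qed (use f in auto)
  moreover have "saturating E f"
    unfolding saturating_def
  proof (intro conjI injI allI)
    show "(i, f i) \<in> E" for i
      using F f by (auto simp: row_saturating_matching_def matching_def)
    show "i = k" if "f i = f k" for i k
    proof -
      have "\<forall>e\<in>F. \<forall>e'\<in>F. snd e = snd e' \<longrightarrow> e = e'"
        using F by (simp add: row_saturating_matching_def matching_def)
      from this[rule_format, OF f[of i] f[of k]] have "(i, f i) = (k, f k)" using that by simp
      then show ?thesis by simp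
    qed
  qed
  ultimately show "\<exists>f. saturating E f \<and> F = range (\<lambda>i. (i, f i))" by blast
next
  assume "\<exists>f. saturating E f \<and> F = range (\<lambda>i. (i, f i))"
  then obtain f where f: "saturating E f" "F = range (\<lambda>i. (i, f i))" by blast
  have "card F = CARD('p)" unfolding f(2) by (rule card_image) (simp add: inj_on_def)
  then show "row_saturating_matching E F"
    using f by (auto simp: saturating_def row_saturating_matching_def matching_def inj_def)
qed

lemma nonredundant_edges_iff:
  fixes E :: "('p::finite \<times> 'v::finite) set"
  shows "(i, j) \<in> nonredundant_edges E \<longleftrightarrow> (\<exists>f. saturating E f \<and> f i = j)"
proof -
  have "(i, j) \<in> range (\<lambda>i. (i, f i)) \<longleftrightarrow> f i = j" for f :: "'p \<Rightarrow> 'v" by auto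
  then show ?thesis
    unfolding nonredundant_edges_def redundant_def row_saturating_matching_iff
    by (auto simp: saturating_def)
qed

lemma nonredundant_edges_subset: "nonredundant_edges E \<subseteq> E"
  by (auto simp: nonredundant_edges_def)

lemma saturating_nonredundant:
  fixes E :: "('p::finite \<times> 'v::finite) set"
  assumes "saturating E f"
  shows "(i, f i) \<in> nonredundant_edges E"
  using assms nonredundant_edges_iff by blast

text \<open>Follow the alternating walk of \<open>f\<close> and \<open>f1\<close> from the row that \<open>f\<close> matches to \<open>c\<close>, and
  exchange \<open>f\<close> for \<open>f1\<close> along it. If the walk meets \<open>r\<close>, exchanging its part from \<open>r\<close> on releases
  the column \<open>f r\<close>; otherwise exchanging all of it releases \<open>c\<close>, which \<open>r\<close> can then use.\<close>

lemma release_column: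
  assumes f: "saturating E f" and rc: "(r, c) \<in> E" and f1: "saturating E f1" "c \<notin> range f1"
  shows "\<exists>f'. saturating E f' \<and> f r \<notin> range f'"
proof -
  have inj: "f i = f k \<Longrightarrow> i = k" "f1 i = f1 k \<Longrightarrow> i = k" for i k
    using f f1 by (auto simp: saturating_def inj_def)
  \<comment> \<open>A matching that keeps \<open>f r\<close> and misses \<open>c\<close> settles the
    claim: move \<open>r\<close> to \<open>c\<close>.\<close>
  have switch: "\<exists>f'. saturating E f' \<and> f r \<notin> range f'"
    if g: "saturating E g" "g r = f r" "c \<notin> range g" for g
  proof -
    have "saturating E (g(r := c))"
      using g rc by (auto simp: saturating_def inj_on_fun_updI)
    moreover have "f r \<notin> range (g(r := c))"
    proof
      assume "f r \<in> range (g(r := c))"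
      then obtain k where "(g(r := c)) k = g r" unfolding g(2) by (metis rangeE)
      then show False
        using g(1,3) by (cases "k = r") (auto simp: saturating_def inj_def)
    qed
    ultimately show ?thesis by blast
  qed
  define shift where "shift = (\<lambda>W i. if i \<in> W then f1 i else f i)"
  \<comment> \<open>Closedness of \<open>W\<close> keeps the \<open>f1\<close> columns used inside
    \<open>W\<close> disjoint from the \<open>f\<close> columns used outside it.\<close>
  have shift: "saturating E (shift W)" if "\<And>i k. i \<in> W \<Longrightarrow> f k = f1 i \<Longrightarrow> k \<in> W" for W
    unfolding saturating_def
  proof (intro conjI injI allI)
    show "i = k" if "shift W i = shift W k" for i k
      using that \<open>\<And>i k. i \<in> W \<Longrightarrow> f k = f1 i \<Longrightarrow> k \<in> W\<close> inj
      by (auto simp: shift_def split: if_splits)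
    show "(i, shift W i) \<in> E" for i
      using f f1 by (auto simp: shift_def saturating_def)
  qed
  \<comment> \<open>The alternating walk: from a row to the one that \<open>f\<close> matches to its
    \<open>f1\<close> column. Injectivity of \<open>f\<close> and \<open>f1\<close> makes it
    deterministic in both directions.\<close>
  define \<phi> where "\<phi> = {(i, k). f k = f1 i}"
  have sat: "saturating E (shift (\<phi>\<^sup>* `` {i}))" for i
  proof (rule shift)
    fix l k assume l: "l \<in> \<phi>\<^sup>* `` {i}" and "f k = f1 l"
    then have "(l, k) \<in> \<phi>" by (simp add: \<phi>_def)
    with l show "k \<in> \<phi>\<^sup>* `` {i}" by (auto intro: rtrancl_into_rtrancl)
  qed
  show ?thesis
  proof (cases "c \<in> range f")
    case False
    then show ?thesis using switch[OF f] by blast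
  next
    case True
    then obtain r1 where r1: "f r1 = c" by blast
    show ?thesis
    proof (cases "(r1, r) \<in> \<phi>\<^sup>*")
      case False
      have "c \<notin> range (shift (\<phi>\<^sup>* `` {r1}))"
        using f1(2) r1 inj by (auto simp: shift_def)
      moreover have "shift (\<phi>\<^sup>* `` {r1}) r = f r" using False by (simp add: shift_def)
      ultimately show ?thesis using switch[OF sat] by blast
    next
      case walk: True
      have "f r \<notin> range (shift (\<phi>\<^sup>* `` {r}))"
      proof
        assume "f r \<in> range (shift (\<phi>\<^sup>* `` {r}))"
        then obtain k where k: "(r, k) \<in> \<phi>\<^sup>*" "f1 k = f r"
          using inj by (auto simp: shift_def split: if_splits)
        \<comment> \<open>Here \<open>f1 k = f r\<close> closes a cycle through \<open>r\<close>.
          Every row that leads to \<open>r\<close> then lies on it, in particular \<open>r1\<close>,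
          whose predecessor would have \<open>c\<close> as its \<open>f1\<close> column.\<close>
        have "(r, x) \<in> \<phi>\<^sup>*" if "(x, r) \<in> \<phi>\<^sup>*" for x
          using that
        proof (induction rule: converse_rtrancl_induct)
          case base
          show ?case by simp
        next
          case (step y z)
          have yz: "f z = f1 y" using step by (simp add: \<phi>_def)
          show ?case
            using step.IH
          proof (cases rule: rtranclE)
            case base
            then show ?thesis using yz k inj by metis
          next
            case (step w)
            then have "f z = f1 w" by (simp add: \<phi>_def)
            then show ?thesis using yz inj step by metis
          qed
        qed
        then have "(r, r1) \<in> \<phi>\<^sup>*" using walk by blast
        then obtain w where "f1 w = f r1"
        proof (cases rule: rtranclE)
          case base
          then show ?thesis using k that by blast
        next
          case (step w)
          then show ?thesis using that by (auto simp: \<phi>_def)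
        qed
        then show False using f1(2) r1 by auto
      qed
      then show ?thesis using sat by blast
    qed
  qed
qed

section \<open>Columns covered by every saturating matching\<close>

definition essential_column :: "('p \<times> 'v) set \<Rightarrow> 'v \<Rightarrow> bool" where
  "essential_column E j \<longleftrightarrow> (\<forall>f. saturating E f \<longrightarrow> j \<in> range f)"

text \<open>With a matching that avoids \<open>j'\<close> and the edge \<open>(i, j')\<close>,
  \<open>release_column\<close> would free \<open>j\<close> from a matching that contains
  \<open>(i, j)\<close>.\<close>

lemma essential_column_propagates:
  fixes E :: "('p::finite \<times> 'v::finite) set"
  assumes "essential_column E j" "(i, j) \<in> nonredundant_edges E" "(i, j') \<in> nonredundant_edges E"
  shows "essential_column E j'"
  unfolding essential_column_def
proof (intro allI impI, rule ccontr)
  fix f1 assume f1: "saturating E f1" "j' \<notin> range f1"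
  obtain f where f: "saturating E f" "f i = j" using assms(2) by (auto simp: nonredundant_edges_iff)
  have "(i, j') \<in> E" using assms(3) nonredundant_edges_subset by blast
  from release_column[OF f(1) this f1] show False
    using assms(1) f(2) by (auto simp: essential_column_def)
qed

text \<open>By propagation all columns of the component are essential, hence covered by
  \<open>f\<close>. The edges of \<open>f\<close> stay within components, so \<open>f\<close>
  restricts to a bijection between the rows and the columns of \<open>g\<close>.\<close>

lemma component_of_essential_column:
  fixes E :: "('p::finite \<times> 'v::finite) set"
  assumes E: "saturating E f" and j: "essential_column E j"
  defines "g \<equiv> (adjacency (nonredundant_edges E))\<^sup>* `` {Inr j}"
  shows "card (row_part g) = card (col_part g)"
proof -
  let ?A = "adjacency (nonredundant_edges E)"
  have adj: "(Inl i, Inr j) \<in> ?A" "(Inr j, Inl i) \<in> ?A" if "(i, j) \<in> nonredundant_edges E" for i j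
    using that by (auto simp: adjacency_def)
  \<comment> \<open>At a row the invariant speaks of all neighbouring columns, so the step from a
    row to a column is immediate.\<close>
  have "case x of Inl i \<Rightarrow> \<forall>k. (i, k) \<in> nonredundant_edges E \<longrightarrow> essential_column E k
      | Inr k \<Rightarrow> essential_column E k" if "(Inr j, x) \<in> ?A\<^sup>*" for x
    using that
  proof (induction rule: rtrancl_induct)
    case base
    show ?case using j by simp
  next
    case (step x y)
    then show ?case
      by (auto simp: adjacency_def dest: essential_column_propagates)
  qed
  then have essential: "essential_column E k" if "k \<in> col_part g" for k
    using that by (force simp: g_def col_part_def)
  have "f ` row_part g = col_part g"
  proof safe
    fix i assume "i \<in> row_part g"
    then have "(Inr j, Inl i) \<in> ?A\<^sup>*" by (simp add: g_def row_part_def)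
    from rtrancl_into_rtrancl[OF this adj(1)[OF saturating_nonredundant[OF E]]]
    show "f i \<in> col_part g" by (simp add: g_def col_part_def)
  next
    fix k assume k: "k \<in> col_part g"
    then obtain i where i: "k = f i" using essential[OF k] E by (auto simp: essential_column_def)
    have "(Inr j, Inr (f i)) \<in> ?A\<^sup>*" using k by (simp add: i g_def col_part_def)
    from rtrancl_into_rtrancl[OF this adj(2)[OF saturating_nonredundant[OF E]]]
    have "i \<in> row_part g" by (simp add: g_def row_part_def)
    then show "k \<in> f ` row_part g" using i by blast
  qed
  moreover have "inj_on f (row_part g)"
    using E inj_on_subset[OF _ subset_UNIV] by (auto simp: saturating_def)
  ultimately show ?thesis using card_image by metis
qed

section \<open>Minors of structured matrices\<close>

lemma structured_matrix_nth:
  "structured_matrix E d a $ i $ j = (if (i, j) \<in> E then \<Sum>k\<le>d (i, j). monom (a (i, j, k)) k else 0)"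
  by (simp add: structured_matrix_def)

text \<open>A term of the Leibniz formula can be nonzero only on a saturating matching, whose edges
  are all nonredundant. Repeated columns make both minors vanish.\<close>

lemma minor_nonredundant_edges:
  fixes E :: "('p::finite \<times> 'v::finite) set"
  shows "minor (structured_matrix E d a) \<sigma> = minor (structured_matrix (nonredundant_edges E) d a) \<sigma>"
proof (cases "inj \<sigma>")
  case False
  then obtain k l where kl: "k \<noteq> l" "\<sigma> k = \<sigma> l" by (auto simp: inj_def)
  have "minor M \<sigma> = 0" for M :: "real poly ^ 'v ^ 'p"
    unfolding minor_def by (rule det_identical_columns[OF kl(1)]) (simp add: column_def kl(2))
  then show ?thesis by simp
next
  case True
  let ?M = "structured_matrix E d a" and ?N = "structured_matrix (nonredundant_edges E) d a"
  have "(\<Prod>i\<in>UNIV. ?M $ i $ \<sigma> (\<pi> i)) = (\<Prod>i\<in>UNIV. ?N $ i $ \<sigma> (\<pi> i))" if "\<pi> permutes UNIV" for \<pi>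
  proof (cases "saturating E (\<sigma> \<circ> \<pi>)")
    case sat: True
    have "(i, \<sigma> (\<pi> i)) \<in> nonredundant_edges E" for i
      using saturating_nonredundant[OF sat, of i] by simp
    then show ?thesis
      using sat by (intro prod.cong) (auto simp: structured_matrix_nth saturating_def)
  next
    case False
    have "inj (\<sigma> \<circ> \<pi>)" using True permutes_inj[OF that] by (rule inj_compose)
    then obtain i where i: "(i, \<sigma> (\<pi> i)) \<notin> E" using False by (auto simp: saturating_def)
    then have "?M $ i $ \<sigma> (\<pi> i) = 0" "?N $ i $ \<sigma> (\<pi> i) = 0"
      using nonredundant_edges_subset[of E] by (auto simp: structured_matrix_nth)
    then show ?thesis by (metis (mono_tags, lifting) UNIV_I finite prod_zero)
  qed
  then show ?thesis by (simp add: minor_def det_def)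
qed

lemma polyfun_parameters:
  assumes "(i, j) \<in> E" "k \<le> d (i, j)"
  shows "polyfun (parameters E d) (\<lambda>a. a (i, j, k))"
  by (rule polyfun_var) (use assms in \<open>simp add: parameters_def\<close>)

lemma ppoly_structured_matrix:
  assumes "E' \<subseteq> E"
  shows "ppoly (parameters E d) (\<lambda>a. structured_matrix E' d a $ i $ j)"
proof (cases "(i, j) \<in> E'")
  case True
  then have "(i, j) \<in> E" using assms by blast
  then show ?thesis unfolding structured_matrix_nth
    using True by (auto intro!: ppoly_sum ppoly_monom polyfun_parameters)
qed (simp add: structured_matrix_nth ppoly_const)

lemma ppoly_minor:
  assumes "E' \<subseteq> E"
  shows "ppoly (parameters E d) (\<lambda>a. minor (structured_matrix E' d a) \<sigma>)"
  unfolding minor_def by (rule ppoly_det) (simp add: ppoly_structured_matrix assms)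

text \<open>The parameter point of the constant 0-1 matrix of the matching \<open>f\<close>; it
  witnesses that the minor belonging to \<open>f\<close> is not identically zero.\<close>

definition matching_indicator :: "('p \<Rightarrow> 'v) \<Rightarrow> 'p \<times> 'v \<times> nat \<Rightarrow> real" where
  "matching_indicator f = (\<lambda>(i, j, k). if f i = j \<and> k = 0 then 1 else 0)"

lemma structured_matrix_matching_indicator:
  assumes "\<And>i. (i, f i) \<in> E"
  shows "structured_matrix E d (matching_indicator f) $ i $ j = (if f i = j then 1 else 0)"
proof (cases "f i = j")
  case True
  have "(\<Sum>k\<le>d (i, j). monom (matching_indicator f (i, j, k)) k) = (\<Sum>k\<in>{0}. monom 1 k)"
    by (rule sum.mono_neutral_cong_right) (auto simp: matching_indicator_def True)
  then show ?thesis using assms[of i] True by (auto simp: structured_matrix_nth)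
qed (auto simp: structured_matrix_nth matching_indicator_def)

lemma minor_matching_indicator:
  assumes "saturating E f" "\<And>i. (i, f i) \<in> E'"
  shows "minor (structured_matrix E' d (matching_indicator f)) f = 1"
proof -
  have "(\<chi> i k. structured_matrix E' d (matching_indicator f) $ i $ f k) = mat 1"
    using assms by (auto simp: vec_eq_iff structured_matrix_matching_indicator mat_def
        saturating_def inj_def)
  then show ?thesis by (simp add: minor_def)
qed

lemma coeff_structured_matrix:
  "coeff (structured_matrix E d a $ i $ j) k =
    (if (i, j) \<in> E \<and> k \<le> d (i, j) then a (i, j, k) else 0)"
proof -
  have "(\<Sum>l\<le>d (i, j). coeff (monom (a (i, j, l)) l) k) =
      (if k \<le> d (i, j) then a (i, j, k) else 0)"
    by (simp add: if_distrib sum.delta cong: if_cong)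
  then show ?thesis by (simp add: structured_matrix_nth coeff_sum)
qed

text \<open>Used to move a column that a matching misses: the minor of that matching, and so its set
  of roots, stays fixed.\<close>

lemma minor_structured_matrix_cong:
  assumes "\<And>i j k. j \<in> range \<sigma> \<Longrightarrow> a (i, j, k) = b (i, j, k)"
  shows "minor (structured_matrix E d a) \<sigma> = minor (structured_matrix E d b) \<sigma>"
proof -
  have "structured_matrix E d a $ i $ \<sigma> k = structured_matrix E d b $ i $ \<sigma> k" for i k
    by (rule poly_eqI) (simp add: coeff_structured_matrix assms)
  then show ?thesis by (simp add: minor_def)
qed

lemma cpoly_minor_constant:
  assumes "\<And>i j k. k > 0 \<Longrightarrow> coeff (M $ i $ j) k = 0"
  shows "cpoly (minor M \<sigma>) z = complex_of_real (coeff (minor M \<sigma>) 0)"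
proof -
  have entry: "cpoly (M $ i $ j) z = complex_of_real (coeff (M $ i $ j) 0)" for i j z
    using cpoly_conv_sum[of 1 "M $ i $ j" z] assms[of _ i j] by simp
  have "cpoly (minor M \<sigma>) z = cpoly (minor M \<sigma>) 0"
    by (simp add: minor_def cpoly_det entry)
  then show ?thesis by (simp add: poly_0_coeff_0 coeff_map_poly)
qed

section \<open>Points of full row rank are dense\<close>

text \<open>Among the points outside the given zero set choose one, \<open>a\<close>, with the smallest number of
  rank-dropping \<open>z\<close>. Moving a column missed by some saturating matching leaves the corresponding
  minor unchanged, so only finitely many sets of rank-dropping \<open>z\<close> occur along such a line. One
  of them occurs infinitely often, and by minimality it is the set at \<open>a\<close>, which therefore
  persists however these columns are moved. Moving them to a constant matrix with a nonzero minor
  shows that the set is empty.\<close>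

lemma dense_full_row_rank:
  fixes E :: "('p::finite \<times> 'v::finite) set"
  assumes f0: "saturating E f0"
    and weight0: "\<And>i j. (i, j) \<in> nonredundant_edges E \<Longrightarrow> essential_column E j \<Longrightarrow> d (i, j) = 0"
    and h: "polyfun (parameters E d) h" "nonzero h"
  shows "\<exists>a. h a \<noteq> 0 \<and>
    (\<forall>z. \<exists>\<sigma>. cpoly (minor (structured_matrix (nonredundant_edges E) d a) \<sigma>) z \<noteq> 0)"
proof -
  let ?X = "parameters E d"
  define D where "D = (\<lambda>a \<sigma>. minor (structured_matrix (nonredundant_edges E) d a) \<sigma>)"
  define Z where "Z = (\<lambda>a. {z. \<forall>\<sigma>. cpoly (D a \<sigma>) z = 0})"
  define Fr where "Fr = {j. \<not> essential_column E j}"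
  define col where "col = (\<lambda>x :: 'p \<times> 'v \<times> nat. fst (snd x))"
  \<comment> \<open>Specializes the free columns to the constants of the matching \<open>f0\<close>.
    The other nonredundant entries are constant by \<open>weight0\<close>, so the minors at
    \<open>rep a\<close> are constants.\<close>
  define rep where "rep = (\<lambda>a x. if col x \<in> Fr then matching_indicator f0 x else a x)"
  have "\<forall>j\<in>Fr. \<exists>f. saturating E f \<and> j \<notin> range f" by (auto simp: Fr_def essential_column_def)
  then obtain avoid where avoid: "\<And>j. j \<in> Fr \<Longrightarrow> saturating E (avoid j)"
      "\<And>j. j \<in> Fr \<Longrightarrow> j \<notin> range (avoid j)" by metis
  have ppoly_D: "ppoly ?X (\<lambda>a. D a \<sigma>)" for \<sigma>
    unfolding D_def by (rule ppoly_minor) (rule nonredundant_edges_subset)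
  have D_ind: "D (matching_indicator f) f = 1" if "saturating E f" for f
    unfolding D_def using that by (intro minor_matching_indicator saturating_nonredundant)
  \<comment> \<open>Collects what is asked of a point: \<open>h\<close> is nonzero, and so are the
    \<open>f0\<close> minors at \<open>a\<close> and \<open>rep a\<close> and, for every free
    column, a minor avoiding it. A nonzero constant coefficient certifies each minor.\<close>
  define H where "H = (\<lambda>a. h a * (coeff (D (rep a) f0) 0 * (coeff (D a f0) 0 *
    (\<Prod>j\<in>Fr. coeff (D a (avoid j)) 0))))"
  have polyfun_rep: "polyfun ?X (\<lambda>a. coeff (D (rep a) f0) 0)"
    unfolding rep_def by (rule polyfun_substitute) (rule ppoly_coeff[OF ppoly_D])
  have nonzero_rep: "nonzero (\<lambda>a. coeff (D (rep a) f0) 0)"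
  proof -
    have "rep (matching_indicator f0) = matching_indicator f0" by (simp add: rep_def)
    then show ?thesis using D_ind[OF f0] by (auto simp: nonzero_def intro!: exI[of _ "matching_indicator f0"])
  qed
  have nonzero_D: "nonzero (\<lambda>a. coeff (D a f) 0)" if "saturating E f" for f
    using D_ind[OF that] by (auto simp: nonzero_def intro!: exI[of _ "matching_indicator f"])
  have polyfun_prod_D: "polyfun ?X (\<lambda>a. \<Prod>j\<in>Fr. coeff (D a (avoid j)) 0)"
    by (intro polyfun_prod ppoly_coeff ppoly_D)
  have nonzero_prod_D: "nonzero (\<lambda>a. \<Prod>j\<in>Fr. coeff (D a (avoid j)) 0)"
    by (rule nonzero_prod) (auto intro: nonzero_D avoid ppoly_coeff ppoly_D)
  have polyfun_H: "polyfun ?X H" unfolding H_def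
    by (intro polyfun_mult h polyfun_rep polyfun_prod_D ppoly_coeff ppoly_D)
  have nonzero_H: "nonzero H" unfolding H_def
    by (intro nonzero_mult[where X = ?X] polyfun_mult h polyfun_rep polyfun_prod_D ppoly_coeff
        ppoly_D nonzero_rep nonzero_D nonzero_prod_D f0)
  have H_D: "h a \<noteq> 0" "coeff (D (rep a) f0) 0 \<noteq> 0" "D a f0 \<noteq> 0" "j \<in> Fr \<Longrightarrow> D a (avoid j) \<noteq> 0"
    if "H a \<noteq> 0" for a j
    using that by (auto simp: H_def)
  have finite_Z: "finite (Z a)" if "H a \<noteq> 0" for a
    by (rule finite_subset[OF _ cpoly_roots_finite[OF H_D(3)[OF that]]]) (auto simp: Z_def)
  define m where "m = (LEAST n. \<exists>a. H a \<noteq> 0 \<and> card (Z a) = n)"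
  have "\<exists>n a. H a \<noteq> 0 \<and> card (Z a) = n" using nonzero_H by (auto simp: nonzero_def)
  then have "\<exists>a. H a \<noteq> 0 \<and> card (Z a) = m" unfolding m_def by (rule LeastI_ex)
  then obtain a0 where a0: "H a0 \<noteq> 0" "card (Z a0) = m" by blast
  have minimal: "m \<le> card (Z a)" if "H a \<noteq> 0" for a
    unfolding m_def by (rule Least_le) (use that in blast)
  \<comment> \<open>The columns are moved one at a time. The target \<open>b\<close> may lie on the
    hypersurface \<open>H = 0\<close>, as \<open>rep a0\<close> possibly does.\<close>
  have persist: "Z a \<subseteq> Z b"
    if "finite J" "J \<subseteq> Fr" "H a \<noteq> 0" "card (Z a) = m" "\<And>x. col x \<notin> J \<Longrightarrow> a x = b x" for J a b
    using that
  proof (induction J arbitrary: a b rule: finite_induct)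
    case empty
    then have "a = b" by auto
    then show ?case by simp
  next
    case (insert j J)
    \<comment> \<open>The line \<open>l\<close> moves only column \<open>j\<close>, from its value
      in \<open>a\<close> towards that in \<open>b\<close>.\<close>
    define v where "v = (\<lambda>x. if col x = j then b x - a x else 0)"
    define l where "l = (\<lambda>t x. a x + t * v x)"
    define T where "T = {t. H (l t) \<noteq> 0}"
    have l0: "l 0 = a" by (simp add: l_def)
    have "finite {t. H (l t) = 0}"
      unfolding l_def by (rule polyfun_zeros_on_line[OF polyfun_H, of _ 0]) (simp add: insert.prems)
    moreover have "UNIV = T \<union> {t. H (l t) = 0}" by (auto simp: T_def)
    ultimately have "infinite T" using infinite_UNIV_char_0[where 'a = real] by (metis finite_Un)
    moreover have "finite ((\<lambda>t. Z (l t)) ` T)"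
    proof (rule finite_subset)
      have "D (l t) (avoid j) = D a (avoid j)" for t
        unfolding D_def
      proof (rule minor_structured_matrix_cong)
        fix i j' k assume "j' \<in> range (avoid j)"
        then have "j' \<noteq> j" using avoid(2)[of j] insert.prems(1) by blast
        then show "l t (i, j', k) = a (i, j', k)" by (simp add: l_def v_def col_def)
      qed
      then have "Z (l t) \<subseteq> {z. cpoly (D a (avoid j)) z = 0}" for t
        unfolding Z_def by (metis (mono_tags, lifting) mem_Collect_eq subsetI)
      then show "(\<lambda>t. Z (l t)) ` T \<subseteq> Pow {z. cpoly (D a (avoid j)) z = 0}"
        by blast
      show "finite (Pow {z. cpoly (D a (avoid j)) z = 0})"
        using H_D(4)[OF insert.prems(2)] insert.prems(1) cpoly_roots_finite by simp
    qed
    ultimately obtain t0 where t0: "t0 \<in> T" "infinite {t \<in> T. Z (l t) = Z (l t0)}"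
      using pigeonhole_infinite by blast
    define T' where "T' = {t \<in> T. Z (l t) = Z (l t0)}"
    have T': "infinite T'" using t0 by (simp add: T'_def)
    \<comment> \<open>A root that occurs for infinitely many \<open>t\<close> also occurs at
      \<open>t = 0\<close>, that is, at \<open>a\<close>. Minimality of \<open>m\<close> then gives
      equality.\<close>
    have "Z (l t0) \<subseteq> Z a"
    proof
      fix z assume z: "z \<in> Z (l t0)"
      have "cpoly (D (l 0) \<sigma>) z = 0" for \<sigma>
        unfolding l_def
      proof (rule cpoly_zeros_on_line[OF ppoly_D T'])
        fix t assume "t \<in> T'"
        then have "z \<in> Z (l t)" using z by (simp add: T'_def)
        then show "cpoly (D (\<lambda>x. a x + t * v x) \<sigma>) z = 0" by (simp add: Z_def l_def)
      qed
      then show "z \<in> Z a" by (simp add: Z_def l0)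
    qed
    then have Z_eq: "Z (l t0) = Z a"
      by (rule card_seteq[OF finite_Z[OF insert.prems(2)]])
        (use minimal[of "l t0"] t0(1) insert.prems(3) in \<open>simp add: T_def\<close>)
    \<comment> \<open>\<open>b' t\<close> takes column \<open>j\<close> from \<open>l t\<close> and
      all else from \<open>b\<close>. It differs from \<open>l t\<close> only in the columns
      \<open>J\<close>, so the induction hypothesis applies, and \<open>t = 1\<close> gives
      \<open>b\<close>.\<close>
    define b' where "b' = (\<lambda>t x. (b x - v x) + t * v x)"
    have b'1: "b' 1 = b" by (simp add: b'_def)
    have mem: "z \<in> Z (b' t)" if z: "z \<in> Z a" and t: "t \<in> T'" for z t
    proof -
      have Zt: "Z (l t) = Z a" using t Z_eq by (simp add: T'_def)
      have "Z (l t) \<subseteq> Z (b' t)"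
      proof (rule insert.IH)
        show "J \<subseteq> Fr" using insert.prems(1) by simp
        show "H (l t) \<noteq> 0" using t by (simp add: T'_def T_def)
        show "card (Z (l t)) = m" by (simp add: Zt insert.prems)
        show "l t x = b' t x" if "col x \<notin> J" for x
          using insert.prems(4)[of x] that by (cases "col x = j") (auto simp: l_def b'_def v_def)
      qed
      then show ?thesis using z Zt by blast
    qed
    show ?case
    proof
      fix z assume z: "z \<in> Z a"
      have "cpoly (D (b' 1) \<sigma>) z = 0" for \<sigma>
        unfolding b'_def
      proof (rule cpoly_zeros_on_line[OF ppoly_D T'])
        fix t assume "t \<in> T'"
        then have "z \<in> Z (b' t)" using mem z by blast
        then show "cpoly (D (\<lambda>x. b x - v x + t * v x) \<sigma>) z = 0" by (simp add: Z_def b'_def)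
      qed
      then show "z \<in> Z b" by (simp add: Z_def b'1)
    qed
  qed
  have "Z a0 \<subseteq> Z (rep a0)"
    by (rule persist[OF _ order_refl a0]) (auto simp: rep_def)
  moreover have "z \<notin> Z (rep a0)" for z
  proof -
    have "cpoly (D (rep a0) f0) z = complex_of_real (coeff (D (rep a0) f0) 0)"
      unfolding D_def
    proof (rule cpoly_minor_constant)
      fix i j and k :: nat assume "k > 0"
      then show "coeff (structured_matrix (nonredundant_edges E) d (rep a0) $ i $ j) k = 0"
        using weight0[of i j]
        by (auto simp: coeff_structured_matrix rep_def col_def Fr_def matching_indicator_def)
    qed
    then have "cpoly (D (rep a0) f0) z \<noteq> 0" using H_D(2)[OF a0(1)] by simp
    then show ?thesis by (auto simp: Z_def)
  qed
  ultimately have "Z a0 = {}" by blast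
  then show ?thesis using H_D(1)[OF a0(1)] by (auto simp: Z_def D_def)
qed

section \<open>Square components\<close>

lemma full_row_rank_eval_iff:
  fixes E :: "('p::finite \<times> 'v::finite) set"
  shows "full_row_rank (eval_matrix (structured_matrix E d a) z) \<longleftrightarrow>
    (\<exists>\<sigma>. cpoly (minor (structured_matrix (nonredundant_edges E) d a) \<sigma>) z \<noteq> 0)"
  unfolding full_row_rank_iff_minor minor_eval_matrix by (simp add: minor_nonredundant_edges[of E])

lemma holds_generically_iff_polyfun:
  "holds_generically E d P \<longleftrightarrow> (\<exists>F. polyfun (parameters E d) F \<and> nonzero F \<and>
    (\<forall>a \<in> parameters E d \<rightarrow>\<^sub>E UNIV. \<not> P (structured_matrix E d a) \<longrightarrow> F a = 0))"
proof -
  have eq: "{a \<in> A. \<not> P (structured_matrix E d a)} \<subseteq> {a \<in> A. F a = 0} \<longleftrightarrow>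
      (\<forall>a\<in>A. \<not> P (structured_matrix E d a) \<longrightarrow> F a = 0)"
    for A and F :: "_ \<Rightarrow> real" by blast
  show ?thesis
    unfolding holds_generically_def eq
    by (rule ex_multi_poly_iff_polyfun[of "parameters E d"
        "\<lambda>F. \<forall>a \<in> parameters E d \<rightarrow>\<^sub>E UNIV. \<not> P (structured_matrix E d a) \<longrightarrow> F a = 0"])
qed

text \<open>Reconciles the extensional points in the definition of genericity with the arbitrary
  points at which polynomial functions are evaluated.\<close>

lemma structured_matrix_restrict:
  "structured_matrix E d (restrict a (parameters E d)) = structured_matrix E d a"
proof -
  have "structured_matrix E d (restrict a (parameters E d)) $ i $ j = structured_matrix E d a $ i $ j"
    for i j
    by (rule poly_eqI) (simp add: coeff_structured_matrix parameters_def)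
  then show ?thesis by (simp add: vec_eq_iff)
qed

text \<open>The columns of the block are labelled by its rows via the matching \<open>f\<close>, and the block is
  completed by an identity block to a matrix indexed by all rows.\<close>

definition square_block ::
    "'p set \<Rightarrow> ('p \<Rightarrow> 'v) \<Rightarrow> 'a::comm_ring_1 ^ 'v ^ 'p \<Rightarrow> 'a ^ 'p ^ 'p" where
  "square_block R f M = (\<chi> i k. if i \<in> R \<and> k \<in> R then M $ i $ f k else if i = k then 1 else 0)"

text \<open>The identity block forces \<open>x\<close> to vanish off \<open>R\<close>, and the rows
  in \<open>R\<close> have nonzero entries only in the columns of the block.\<close>

lemma left_kernel_square_block:
  fixes M :: "'a::field ^ 'v ^ 'p"
  assumes zero: "\<And>i j. i \<in> R \<Longrightarrow> j \<notin> f ` R \<Longrightarrow> M $ i $ j = 0"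
    and x: "x v* square_block R f M = 0"
  shows "x v* M = 0"
proof -
  have sum0: "(\<Sum>i\<in>UNIV. x $ i * square_block R f M $ i $ k) = 0" for k
    using arg_cong[OF x, of "\<lambda>y. y $ k"] by (simp add: vector_matrix_mult_def mult.commute)
  have x0: "x $ k = 0" if "k \<notin> R" for k
    using sum0[of k] that by (simp add: square_block_def if_distrib cong: if_cong)
  have "(\<Sum>i\<in>UNIV. x $ i * M $ i $ j) = 0" for j
  proof (cases "j \<in> f ` R")
    case True
    then obtain k where k: "k \<in> R" "j = f k" by blast
    have "(\<Sum>i\<in>UNIV. x $ i * M $ i $ j) = (\<Sum>i\<in>UNIV. x $ i * square_block R f M $ i $ k)"
      by (rule sum.cong) (use x0 k in \<open>auto simp: square_block_def\<close>)
    then show ?thesis using sum0 by simp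
  next
    case False
    then have "x $ i * M $ i $ j = 0" for i using x0[of i] zero[of i j] by auto
    then show ?thesis by (intro sum.neutral ballI)
  qed
  then show ?thesis by (simp add: vec_eq_iff vector_matrix_mult_def mult.commute)
qed

lemma cpoly_det_square_block:
  "cpoly (det (square_block R f M)) z = det (square_block R f (eval_matrix M z))"
  unfolding cpoly_det
  by (rule arg_cong[of _ _ det])
    (simp add: vec_eq_iff square_block_def eval_matrix_def map_matrix_def)

text \<open>The product of the nonzero entries picked out by the matching \<open>f\<close>, one of which is
  \<open>s ^ d (i0, f i0)\<close>, is the only term of the determinant.\<close>

lemma det_square_block_witness:
  fixes E :: "('p::finite \<times> 'v::finite) set"
  assumes f: "saturating E f" and i0: "i0 \<in> R"
  shows "\<exists>a. det (square_block R f (structured_matrix (nonredundant_edges E) d a)) =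
    monom 1 (d (i0, f i0))"
proof -
  \<comment> \<open>Row \<open>i0\<close> keeps only the top coefficient of its entry in column
    \<open>f i0\<close>; all other rows follow the matching.\<close>
  define a where "a = (\<lambda>x. if fst x = i0 then if x = (i0, f i0, d (i0, f i0)) then 1 else 0
    else matching_indicator f x)"
  let ?M = "structured_matrix (nonredundant_edges E) d a"
  have "?M $ i $ f k = (if i = k then if i = i0 then monom 1 (d (i0, f i0)) else 1 else 0)" for i k
    using saturating_nonredundant[OF f] f
    by (intro poly_eqI)
      (auto simp: coeff_structured_matrix a_def matching_indicator_def saturating_def inj_def)
  then have "square_block R f ?M =
      (\<chi> i k. if i = k then if i = i0 then monom 1 (d (i0, f i0)) else 1 else 0)"
    using i0 by (auto simp: square_block_def vec_eq_iff)
  then have "det (square_block R f ?M) = (\<Prod>i\<in>UNIV. if i = i0 then monom 1 (d (i0, f i0)) else 1)"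
    by (simp add: det_diagonal)
  then show ?thesis by (intro exI[of _ a]) simp
qed

text \<open>A matching through the edge maps the rows of the component onto its columns, so these
  rows have nonredundant entries only in a square block. If the weight were positive, the
  determinant of the block would generically have positive degree, and a left kernel vector at a
  root would drop the rank.\<close>

lemma square_component_weight_zero:
  fixes E :: "('p::finite \<times> 'v::finite) set"
  assumes generic: "holds_generically E d (\<lambda>M. \<forall>z. full_row_rank (eval_matrix M z))"
    and g: "g \<in> graph_components (nonredundant_edges E)"
    and card: "card (row_part g) = card (col_part g)"
    and e: "(i0, j0) \<in> component_edges (nonredundant_edges E) g"
  shows "d (i0, j0) = 0"
proof (rule ccontr)
  assume d0: "d (i0, j0) \<noteq> 0"
  let ?N = "structured_matrix (nonredundant_edges E) d" and ?X = "parameters E d"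
  let ?A = "adjacency (nonredundant_edges E)" and ?R = "row_part g"
  obtain x where x: "g = ?A\<^sup>* `` {x}"
    using g by (auto simp: graph_components_def elim: quotientE)
  have col: "j \<in> col_part g" if "i \<in> ?R" "(i, j) \<in> nonredundant_edges E" for i j
  proof -
    have "(x, Inl i) \<in> ?A\<^sup>*" using that(1) by (simp add: x row_part_def)
    moreover have "(Inl i, Inr j) \<in> ?A" using that(2) by (auto simp: adjacency_def)
    ultimately have "(x, Inr j) \<in> ?A\<^sup>*" by (rule rtrancl_into_rtrancl)
    then show ?thesis by (simp add: x col_part_def)
  qed
  have i0: "i0 \<in> ?R" and "(i0, j0) \<in> nonredundant_edges E"
    using e by (auto simp: component_edges_def row_part_def)
  then obtain f where f: "saturating E f" "f i0 = j0" by (auto simp: nonredundant_edges_iff)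
  have "f ` ?R \<subseteq> col_part g" using col saturating_nonredundant[OF f(1)] by auto
  moreover have "card (f ` ?R) = card ?R"
    by (rule card_image, rule inj_on_subset[OF _ subset_UNIV])
      (use f(1) in \<open>simp add: saturating_def\<close>)
  ultimately have image: "f ` ?R = col_part g" using card by (intro card_subset_eq) auto
  \<comment> \<open>Where this coefficient is nonzero, the determinant has degree at least
    \<open>d (i0, j0)\<close>, which is positive by \<open>d0\<close>.\<close>
  let ?h = "\<lambda>a. coeff (det (square_block ?R f (?N a))) (d (i0, j0))"
  have "ppoly ?X (\<lambda>a. square_block ?R f (?N a) $ i $ k)" for i k
    using ppoly_structured_matrix[OF nonredundant_edges_subset, of E d i "f k"]
    by (cases "i \<in> ?R \<and> k \<in> ?R") (auto simp: square_block_def ppoly_const)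
  then have polyfun_h: "polyfun ?X ?h" by (intro ppoly_coeff ppoly_det)
  obtain b where "det (square_block ?R f (?N b)) = monom 1 (d (i0, j0))"
    using det_square_block_witness[OF f(1) i0, of d] unfolding f(2) by blast
  then have "?h b = 1" by simp
  then have nonzero_h: "nonzero ?h" unfolding nonzero_def by (intro exI[of _ b]) simp
  obtain F where F: "polyfun ?X F" "nonzero F"
    "\<And>a. a \<in> ?X \<rightarrow>\<^sub>E UNIV \<Longrightarrow> F a \<noteq> 0 \<Longrightarrow> \<forall>z. full_row_rank (eval_matrix (structured_matrix E d a) z)"
    using generic unfolding holds_generically_iff_polyfun by blast
  obtain a where a: "F a \<noteq> 0" "?h a \<noteq> 0"
    using nonzero_mult[OF F(1) polyfun_h F(2) nonzero_h] by (auto simp: nonzero_def)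
  have "F (restrict a ?X) = F a" by (rule polyfun_cong[OF F(1)]) simp
  then have rank: "full_row_rank (eval_matrix (structured_matrix E d a) z)" for z
    using F(3)[of "restrict a ?X"] a(1) by (simp add: structured_matrix_restrict)
  have "degree (det (square_block ?R f (?N a))) > 0"
    using le_degree[OF a(2)] d0 by simp
  from cpoly_has_root[OF this] obtain z where "det (square_block ?R f (eval_matrix (?N a) z)) = 0"
    unfolding cpoly_det_square_block ..
  then obtain y where y: "y \<noteq> 0" "y v* square_block ?R f (eval_matrix (?N a) z) = 0"
    using left_kernel_trivial_iff_det[of "square_block ?R f (eval_matrix (?N a) z)"] by auto
  have "eval_matrix (?N a) z $ i $ j = 0" if "i \<in> ?R" "j \<notin> f ` ?R" for i j
    using col[OF that(1), of j] that(2) image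
    by (auto simp: eval_matrix_def map_matrix_def structured_matrix_nth)
  from left_kernel_square_block[OF this y(2)] have "y v* eval_matrix (?N a) z = 0" by blast
  then have "\<not> full_row_rank (eval_matrix (?N a) z)"
    using y(1) full_row_rank_iff_left_kernel by blast
  moreover have "full_row_rank (eval_matrix (?N a) z)"
    using rank[of z] full_row_rank_eval_iff[of E d a z]
    by (simp add: full_row_rank_iff_minor minor_eval_matrix)
  ultimately show False by blast
qed

section \<open>Sufficiency of the weight condition\<close>

lemma holds_generically_if_weights_zero:
  fixes E :: "('p::finite \<times> 'v::finite) set"
  assumes f: "saturating E f"
    and weights: "\<And>g e. \<lbrakk>g \<in> graph_components (nonredundant_edges E);
      card (row_part g) = card (col_part g); e \<in> component_edges (nonredundant_edges E) g\<rbrakk>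
      \<Longrightarrow> d e = 0"
  shows "holds_generically E d (\<lambda>M. \<forall>z. full_row_rank (eval_matrix M z))"
proof -
  let ?D = "\<lambda>\<sigma> a. minor (structured_matrix (nonredundant_edges E) d a) \<sigma>"
  let ?A = "adjacency (nonredundant_edges E)"
  have weight0: "d (i, j) = 0"
    if "(i, j) \<in> nonredundant_edges E" "essential_column E j" for i j
  proof (rule weights)
    show "?A\<^sup>* `` {Inr j} \<in> graph_components (nonredundant_edges E)"
      by (auto simp: graph_components_def intro: quotientI)
    show "card (row_part (?A\<^sup>* `` {Inr j})) = card (col_part (?A\<^sup>* `` {Inr j}))"
      by (rule component_of_essential_column[OF f that(2)])
    have "(Inr j, Inl i) \<in> ?A" using that(1) by (auto simp: adjacency_def)
    then show "(i, j) \<in> component_edges (nonredundant_edges E) (?A\<^sup>* `` {Inr j})"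
      using that(1) by (auto simp: component_edges_def)
  qed
  have ppoly: "ppoly (parameters E d) (?D \<sigma>)" for \<sigma>
    by (rule ppoly_minor) (rule nonredundant_edges_subset)
  consider (no_root) h where "polyfun (parameters E d) h" "nonzero h"
      "\<And>a z. h a \<noteq> 0 \<Longrightarrow> \<exists>\<sigma>\<in>UNIV. cpoly (?D \<sigma> a) z \<noteq> 0"
    | (root) h where "polyfun (parameters E d) h" "nonzero h"
      "\<And>a. h a \<noteq> 0 \<Longrightarrow> \<exists>z. \<forall>\<sigma>\<in>UNIV. cpoly (?D \<sigma> a) z = 0"
    by (rule generic_root_dichotomy[of "UNIV :: ('p \<Rightarrow> 'v) set" "parameters E d" ?D])
      (use ppoly in auto)
  then show ?thesis
  proof cases
    case no_root
    then show ?thesis unfolding holds_generically_iff_polyfun full_row_rank_eval_iff by blast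
  next
    case root
    \<comment> \<open>This case is contradictory: some point outside the zero set of
      \<open>h\<close> has no common root of the minors.\<close>
    then show ?thesis
      using dense_full_row_rank[OF f weight0 root(1,2)] by blast
  qed
qed

theorem theorem5:
  fixes M :: "real poly ^ 'v ^ 'p"
  assumes "poly_full_row_rank M"
    and "\<exists>F. row_saturating_matching (edges M) F"
  shows "holds_generically (edges M) (weight M) (\<lambda>M'. \<forall>z. full_row_rank (eval_matrix M' z)) \<longleftrightarrow>
    (\<forall>g \<in> graph_components (nonredundant_edges (edges M)).
       card (row_part g) = card (col_part g) \<longrightarrow>
       (\<forall>e \<in> component_edges (nonredundant_edges (edges M)) g. weight M e = 0))"
proof -
  obtain f where "saturating (edges M) f"
    using assms(2) by (auto simp: row_saturating_matching_iff)
  then show ?thesis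
    using square_component_weight_zero[of "edges M" "weight M"]
      holds_generically_if_weights_zero[of "edges M" f "weight M"]
    by (metis surj_pair)
qed

end
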